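(* Let $N\ge 1$, let $p$ satisfy $2p\in(2,2^* )$, and let $0<\mathsf m_1\le \mathsf m_2$. Then there exist a constant $\tilde\beta_{\mathsf m_1,\mathsf m_2,p}>0$ and a decreasing function $\vartheta:(0,\tilde\beta_{\mathsf m_1,\mathsf m_2,p})\to(0,+\infty)$ such that for every $\beta$ with $0<\beta<\tilde\beta_{\mathsf m_1,\mathsf m_2,p}$ the following holds: for every $k\in\mathbb N$ there exist no $\delta_1,\dots,\delta_k\in[0,\vartheta(\beta))$ such that $$\sum_{i=1}^k\mathcal C_{\mathsf m_1+\delta_i,0}\in\big[\mathcal C_{\mathsf m_1,\beta}+\mathcal C_{\mathsf m_2,\beta},\ \mathcal C^*_{\mathsf m_1,\mathsf m_2,\beta}\big].$$
   Context: $2^*=\frac{2N}{N-2}$ if $N\ge3$ and $2^*=+\infty$ if $N=1,2$. $|u|_q$ is the $L^q(\mathbb R^N)$ norm, $\beta_+=\max\{\beta,0\}$, and for $\alpha>0$, $\|u\|_\alpha^2=\int_{\mathbb R^N}(|\nabla u|^2+\alpha u^2)$ for $u\in H^1(\mathbb R^N)$. For $\alpha>0$ and $\beta\in\mathbb R$, $U_{\alpha,\beta_+}$ denotes the ground state (positive, radially symmetric about the origin) in $H^1(\mathbb R^N)$ of $-\Delta u+\alpha u=(1+\beta_+)|u|^{2p-2}u$ in $\mathbb R^N$, $J_{\alpha,\beta_+}(u)=\frac12\|u\|_\alpha^2-\frac{1+\beta_+}{2p}|u|_{2p}^{2p}$, and $\mathcal C_{\alpha,\beta}:=\mathcal C_{\alpha,\beta_+}:=J_{\alpha,\beta_+}(U_{\alpha,\beta_+})$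 for $\beta\ge0$. For $\alpha_1,\alpha_2>0$, $\beta\in\mathbb R$ and $w=(u_1,u_2)\in H^1(\mathbb R^N)\times H^1(\mathbb R^N)$, $$J_{\alpha_1,\alpha_2,\beta}(w)=\tfrac12\big(\|u_1\|_{\alpha_1}^2+\|u_2\|_{\alpha_2}^2\big)-\tfrac1{2p}|u_1|_{2p}^{2p}-\tfrac1{2p}|u_2|_{2p}^{2p}-\tfrac{\beta}{p}|u_1u_2|_p^p,$$ $$\mathcal C^*_{\alpha_1,\alpha_2,\beta}:=\max_{t,s>0}J_{\alpha_1,\alpha_2,\beta}\big((tU_{\alpha_1,\beta_+},sU_{\alpha_2,\beta_+})\big).$$ *)

theory Defs
  imports "HOL-Analysis.Analysis"
begin

text \<open>
  Elements of \<open>L\<^sup>q(\<real>\<^sup>N)\<close> and \<open>H\<^sup>1(\<real>\<^sup>N)\<close> are represented by Borel functions on \<^typ>\<open>real ^ 'n\<close>,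
  where \<open>N = CARD('n)\<close>; statements about equivalence classes are read up to null sets of
  \<^const>\<open>lborel\<close>.
\<close>

definition crit_exponent :: "nat \<Rightarrow> ereal" where
  "crit_exponent N = (if N \<ge> 3 then ereal (2 * real N / (real N - 2)) else \<infinity>)"

definition Lq_norm :: "real \<Rightarrow> (real ^ 'n \<Rightarrow> real) \<Rightarrow> real" where
  "Lq_norm q u = (\<integral>x. \<bar>u x\<bar> powr q \<partial>lborel) powr (1 / q)"

definition square_integrable :: "(real ^ 'n \<Rightarrow> 'b::euclidean_space) \<Rightarrow> bool" where
  "square_integrable f \<longleftrightarrow> f \<in> borel_measurable lborel \<and> integrable lborel (\<lambda>x. (norm (f x))\<^sup>2)"

text \<open>
  \<open>C\<^sup>1\<close> test functions with compact support, given together with their gradient. As in Brezis'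
  textbook, \<open>H\<^sup>1\<close> is defined with this class; \<open>C\<^sup>\<infinity>\<close> test functions with compact
  support yield the same space and the same weak gradients, by mollification.
\<close>

definition test_function :: "(real ^ 'n \<Rightarrow> real) \<Rightarrow> (real ^ 'n \<Rightarrow> real ^ 'n) \<Rightarrow> bool" where
  "test_function \<phi> D\<phi> \<longleftrightarrow>
     (\<forall>x. GDERIV \<phi> x :> D\<phi> x) \<and> continuous_on UNIV D\<phi> \<and> compact (closure {x. \<phi> x \<noteq> 0})"

definition is_weak_gradient :: "(real ^ 'n \<Rightarrow> real) \<Rightarrow> (real ^ 'n \<Rightarrow> real ^ 'n) \<Rightarrow> bool" where
  "is_weak_gradient u G \<longleftrightarrow>
     (\<forall>\<phi> D\<phi>. test_function \<phi> D\<phi> \<longrightarrow>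
        (\<forall>i. (\<integral>x. u x * D\<phi> x $ i \<partial>lborel) = - (\<integral>x. G x $ i * \<phi> x \<partial>lborel)))"

definition H1 :: "(real ^ 'n \<Rightarrow> real) set" where
  "H1 = {u. square_integrable u \<and> (\<exists>G. square_integrable G \<and> is_weak_gradient u G)}"

text \<open>The weak gradient is unique up to null sets, so the choice does not affect integrals.\<close>

definition weak_gradient :: "(real ^ 'n \<Rightarrow> real) \<Rightarrow> real ^ 'n \<Rightarrow> real ^ 'n" where
  "weak_gradient u = (SOME G. square_integrable G \<and> is_weak_gradient u G)"

definition H1_norm_sq :: "real \<Rightarrow> (real ^ 'n \<Rightarrow> real) \<Rightarrow> real" where
  "H1_norm_sq \<alpha> u = (\<integral>x. (norm (weak_gradient u x))\<^sup>2 + \<alpha> * (u x)\<^sup>2 \<partial>lborel)"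

text \<open>
  Below, \<open>b\<close> stands for \<open>\<beta>\<^sub>+\<close>. Weak solutions in \<open>H\<^sup>1\<close> of
  \<open>-\<Delta>u + \<alpha>u = (1 + b)\<bar>u\<bar>\<^bsup>2p-2\<^esup>u\<close>, that is, critical points of the functional \<open>J_scalar\<close>.
\<close>

definition weak_solution :: "real \<Rightarrow> real \<Rightarrow> real \<Rightarrow> (real ^ 'n \<Rightarrow> real) \<Rightarrow> bool" where
  "weak_solution p \<alpha> b u \<longleftrightarrow> u \<in> H1 \<and>
     (\<forall>v\<in>H1. (\<integral>x. weak_gradient u x \<bullet> weak_gradient v x + \<alpha> * u x * v x \<partial>lborel)
           = (1 + b) * (\<integral>x. \<bar>u x\<bar> powr (2 * p - 2) * u x * v x \<partial>lborel))"

definition J_scalar :: "real \<Rightarrow> real \<Rightarrow> real \<Rightarrow> (real ^ 'n \<Rightarrow> real) \<Rightarrow> real" where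
  "J_scalar p \<alpha> b u =
     1 / 2 * H1_norm_sq \<alpha> u - (1 + b) / (2 * p) * Lq_norm (2 * p) u powr (2 * p)"

text \<open>
  Ground state means a nontrivial solution of least energy among all nontrivial solutions;
  the representative is positive and radial everywhere.
\<close>

definition ground_state :: "real \<Rightarrow> real \<Rightarrow> real \<Rightarrow> (real ^ 'n \<Rightarrow> real) \<Rightarrow> bool" where
  "ground_state p \<alpha> b u \<longleftrightarrow>
     weak_solution p \<alpha> b u \<and>
     (\<forall>x. u x > 0) \<and>
     (\<forall>x y. norm x = norm y \<longrightarrow> u x = u y) \<and>
     (\<forall>v :: real ^ 'n \<Rightarrow> real. weak_solution p \<alpha> b v \<and> \<not> (AE x in lborel. v x = 0)
          \<longrightarrow> J_scalar p \<alpha> b u \<le> J_scalar p \<alpha> b v)"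

definition J_system ::
  "real \<Rightarrow> real \<Rightarrow> real \<Rightarrow> real \<Rightarrow> (real ^ 'n \<Rightarrow> real) \<times> (real ^ 'n \<Rightarrow> real) \<Rightarrow> real" where
  "J_system p \<alpha>\<^sub>1 \<alpha>\<^sub>2 \<beta> w = (case w of (u\<^sub>1, u\<^sub>2) \<Rightarrow>
     1 / 2 * (H1_norm_sq \<alpha>\<^sub>1 u\<^sub>1 + H1_norm_sq \<alpha>\<^sub>2 u\<^sub>2)
     - 1 / (2 * p) * Lq_norm (2 * p) u\<^sub>1 powr (2 * p)
     - 1 / (2 * p) * Lq_norm (2 * p) u\<^sub>2 powr (2 * p)
     - \<beta> / p * Lq_norm p (\<lambda>x. u\<^sub>1 x * u\<^sub>2 x) powr p)"

text \<open>
  In the following, \<open>U \<alpha> b\<close> is the ground state for the parameters \<open>\<alpha>\<close> and \<open>b = \<beta>\<^sub>+\<close>.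
\<close>

definition C_level ::
  "real \<Rightarrow> (real \<Rightarrow> real \<Rightarrow> real ^ 'n \<Rightarrow> real) \<Rightarrow> real \<Rightarrow> real \<Rightarrow> real" where
  "C_level p U \<alpha> \<beta> = J_scalar p \<alpha> (max \<beta> 0) (U \<alpha> (max \<beta> 0))"

text \<open>
  \<^const>\<open>Greatest\<close> is the maximum of a possibly infinite set; it is unspecified if the
  maximum is not attained.
\<close>

definition C_star ::
  "real \<Rightarrow> (real \<Rightarrow> real \<Rightarrow> real ^ 'n \<Rightarrow> real) \<Rightarrow> real \<Rightarrow> real \<Rightarrow> real \<Rightarrow> real" where
  "C_star p U \<alpha>\<^sub>1 \<alpha>\<^sub>2 \<beta> =
     (GREATEST c. \<exists>t>0. \<exists>s>0. c = J_system p \<alpha>\<^sub>1 \<alpha>\<^sub>2 \<beta>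
        (\<lambda>x. t * U \<alpha>\<^sub>1 (max \<beta> 0) x, \<lambda>x. s * U \<alpha>\<^sub>2 (max \<beta> 0) x))"

end

theory Submission
  imports Defs
begin

text \<open>
  Write $\gamma = \frac{p}{p-1} - \frac N2$, which is positive because $2p$ is subcritical.
  If $u$ solves the scalar equation for $(\alpha, b)$, then $x \mapsto c\,u(\lambda x)$ solves it for
  $\alpha' = \lambda^2\alpha$ and a coefficient $b'$ determined by $c$ and $\lambda$, and the energy is
  multiplied by an explicit factor. Since a ground state minimises the energy among all nontrivial
  solutions, comparing in both directions (\<open>ground_state_level\<close>) gives
  \[ \mathcal C_{\alpha,\beta} = (1+\beta)^{-1/(p-1)}\,(\alpha/\alpha')^{\gamma}\,\mathcal C_{\alpha',0}
     \qquad (\beta \ge 0). \]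
  Put $c_i = \mathcal C_{\mathsf m_i,0}$ and $L = c_1 + c_2$. The lower end of the interval is
  $(1+\beta)^{-1/(p-1)} L$, which tends to $L$ from below as $\beta \to 0$. The upper end is strictly
  smaller than $L$: without the coupling term the maximum over $t$ and over $s$ would be exactly $L$,
  and the coupling term, which enters with a negative sign, is nonzero at the maximum point
  (\<open>C_star_less\<close>). So the interval lies in $[L - o(1), L)$.

  A sum of $k$ levels $\mathcal C_{\mathsf m_1+\delta_i,0}$ lies between $k c_1$ and
  $(1 + \max_i\delta_i/\mathsf m_1)^{\gamma}\,k c_1$. Let $K$ be the least integer with $K c_1 \ge L$.
  If $k \ge K$, the sum is at least $L$, above the interval. If $k \le K - 1$, then $k c_1 \le (K-1)c_1 < L$,
  and for small $\beta$ and $\delta_i$ the sum stays below the interval. The strict inequality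
  $\mathcal C^*_{\mathsf m_1,\mathsf m_2,\beta} < L$ is decisive when $L / c_1$ is an integer, because then the sum with
  $k = K$ and all $\delta_i = 0$ equals $L$.

  Two points need care. The gradient of a rescaled function is a choice among weak gradients, so
  computing its norm rests on the uniqueness of weak gradients, that is, on the fundamental lemma of
  the calculus of variations (\<open>AE_zero_if_square_integrable_orthogonal\<close>). And the maximum defining
  $\mathcal C^*$ runs over the open quadrant $t, s > 0$: it is attained because for small $\beta$ the value at
  $t = s = 1$ already exceeds all values on the axes (\<open>coupled_profile_max\<close>). That
  the integrals of $|U|^{2p}$ and $|U_1U_2|^p$ are finite follows from testing the equation with its own
  solution (\<open>weak_solution_integrable\<close>).
\<close>

section \<open>Test functions and the fundamental lemma of the calculus of variations\<close>

lemma test_function_continuous: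
  assumes "test_function \<phi> D\<phi>"
  shows "continuous_on UNIV \<phi>"
proof -
  have "(\<phi> has_derivative (\<lambda>h. h \<bullet> D\<phi> x)) (at x)" for x
    using assms by (simp add: test_function_def gderiv_def)
  then show ?thesis
    by (meson continuous_at_imp_continuous_on has_derivative_continuous)
qed

lemma test_function_measurable:
  assumes "test_function \<phi> D\<phi>"
  shows "\<phi> \<in> borel_measurable borel"
  using test_function_continuous[OF assms] by (rule borel_measurable_continuous_onI)

lemma integrable_square_integrable_mult:
  fixes f g :: "real ^ 'n \<Rightarrow> real"
  assumes "square_integrable f" and "square_integrable g"
  shows "integrable lborel (\<lambda>x. f x * g x)"
proof (rule Bochner_Integration.integrable_bound)
  show "integrable lborel (\<lambda>x. (f x)\<^sup>2 + (g x)\<^sup>2)"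
    using assms by (simp add: square_integrable_def)
  show "(\<lambda>x. f x * g x) \<in> borel_measurable lborel"
    using assms by (auto simp: square_integrable_def)
  have "\<bar>a * b\<bar> \<le> a\<^sup>2 + b\<^sup>2" for a b :: real
  proof -
    have "2 * (\<bar>a\<bar> * \<bar>b\<bar>) \<le> a\<^sup>2 + b\<^sup>2"
      using sum_squares_bound[of "\<bar>a\<bar>" "\<bar>b\<bar>"] by simp
    moreover have "0 \<le> \<bar>a\<bar> * \<bar>b\<bar>" by simp
    ultimately show ?thesis unfolding abs_mult by linarith
  qed
  then show "AE x in lborel. norm (f x * g x) \<le> norm ((f x)\<^sup>2 + (g x)\<^sup>2)"
    by (intro AE_I2) simp
qed

lemma test_function_square_integrable:
  assumes "test_function \<phi> D\<phi>"
  shows "square_integrable \<phi>"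
proof -
  let ?K = "closure {x. \<phi> x \<noteq> 0}"
  have K: "compact ?K"
    using assms by (simp add: test_function_def)
  have "continuous_on ?K (\<lambda>x. (\<phi> x)\<^sup>2)"
    by (intro continuous_intros continuous_on_subset[OF test_function_continuous[OF assms]]) auto
  from borel_integrable_compact[OF K this]
  have "integrable lborel (\<lambda>x. indicator ?K x *\<^sub>R (\<phi> x)\<^sup>2)"
    by (simp add: indicator_def scaleR_conv_of_real if_distrib cong: if_cong)
  moreover have "indicator ?K x *\<^sub>R (\<phi> x)\<^sup>2 = (\<phi> x)\<^sup>2" for x
    using closure_subset[of "{x. \<phi> x \<noteq> 0}"] by (auto simp: indicator_def)
  ultimately have "integrable lborel (\<lambda>x. (\<phi> x)\<^sup>2)" by (simp only:)
  then show ?thesis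
    using test_function_measurable[OF assms] by (simp add: square_integrable_def)
qed

text \<open>
  Compactness of the support is inherited from any test function with a larger nonvanishing set;
  products and saturations of test functions obtain it in this way.
\<close>

lemma test_functionI_support_subset:
  assumes "\<And>x. GDERIV \<phi> x :> D\<phi> x" and "continuous_on UNIV D\<phi>"
    and "test_function \<psi> D\<psi>" and "\<And>x. \<phi> x \<noteq> 0 \<Longrightarrow> \<psi> x \<noteq> 0"
  shows "test_function \<phi> D\<phi>"
proof -
  have "{x. \<phi> x \<noteq> 0} \<subseteq> {x. \<psi> x \<noteq> 0}"
    using assms(4) by auto
  moreover have "bounded {x. \<psi> x \<noteq> 0}"
    using assms(3) by (simp add: test_function_def compact_closure)
  ultimately have "compact (closure {x. \<phi> x \<noteq> 0})"
    unfolding compact_closure by (rule bounded_subset[rotated])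
  with assms(1,2) show ?thesis by (simp add: test_function_def)
qed

lemma test_function_mult:
  assumes "test_function \<phi> D\<phi>" and "test_function \<psi> D\<psi>"
  shows "test_function (\<lambda>x. \<phi> x * \<psi> x) (\<lambda>x. \<phi> x *\<^sub>R D\<psi> x + \<psi> x *\<^sub>R D\<phi> x)"
proof (rule test_functionI_support_subset[OF _ _ assms(1)])
  show "GDERIV (\<lambda>x. \<phi> x * \<psi> x) x :> \<phi> x *\<^sub>R D\<psi> x + \<psi> x *\<^sub>R D\<phi> x" for x
    using assms by (intro GDERIV_mult) (auto simp: test_function_def)
  show "continuous_on UNIV (\<lambda>x. \<phi> x *\<^sub>R D\<psi> x + \<psi> x *\<^sub>R D\<phi> x)"
    using assms test_function_continuous[OF assms(1)] test_function_continuous[OF assms(2)]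
    by (intro continuous_intros) (auto simp: test_function_def)
qed auto

lemma test_function_zero: "test_function (\<lambda>x. 0) (\<lambda>x. 0)"
  by (simp add: test_function_def GDERIV_const)

lemma test_function_add:
  assumes "test_function \<phi> D\<phi>" and "test_function \<psi> D\<psi>"
  shows "test_function (\<lambda>x. \<phi> x + \<psi> x) (\<lambda>x. D\<phi> x + D\<psi> x)"
proof -
  have "bounded ({x. \<phi> x \<noteq> 0} \<union> {x. \<psi> x \<noteq> 0})"
    using assms by (simp add: test_function_def compact_closure)
  then have "bounded {x. \<phi> x + \<psi> x \<noteq> 0}"
    by (rule bounded_subset) auto
  then show ?thesis
    using assms by (auto simp: test_function_def compact_closure intro!: GDERIV_add continuous_intros)
qed

lemma test_function_sum:
  fixes n :: nat
  assumes "\<And>i. test_function (\<phi> i) (D\<phi> i)"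
  shows "test_function (\<lambda>x. \<Sum>i<n. \<phi> i x) (\<lambda>x. \<Sum>i<n. D\<phi> i x)"
proof (induction n)
  case 0
  then show ?case by (simp add: test_function_zero)
next
  case (Suc n)
  show ?case using test_function_add[OF Suc assms[of n]] by simp
qed

text \<open>
  For $c \to \infty$ the saturation $c\phi/(1 + c\phi)$ of a nonnegative $\phi$ increases to the indicator of
  $\{\phi \ne 0\}$ while staying in $[0, 1)$, and it is again $C^1$ because $s \mapsto cs/(1+cs)$ is smooth
  on $[0, \infty)$. It plays the role of a mollified indicator.
\<close>

lemma test_function_saturate:
  assumes "test_function \<phi> D\<phi>" and "\<And>x. \<phi> x \<ge> 0" and "c \<ge> 0"
  shows "test_function (\<lambda>x. c * \<phi> x / (1 + c * \<phi> x)) (\<lambda>x. (c / (1 + c * \<phi> x)\<^sup>2) *\<^sub>R D\<phi> x)"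
proof (rule test_functionI_support_subset[OF _ _ assms(1)])
  have pos: "1 + c * \<phi> x > 0" for x
    using assms(2)[of x] assms(3) by (simp add: add_pos_nonneg)
  have "((\<lambda>s. c * s / (1 + c * s)) has_real_derivative c / (1 + c * \<phi> x)\<^sup>2) (at (\<phi> x))" for x
    using pos[of x] by (auto intro!: derivative_eq_intros simp: field_simps power2_eq_square)
  then show "GDERIV (\<lambda>x. c * \<phi> x / (1 + c * \<phi> x)) x :> (c / (1 + c * \<phi> x)\<^sup>2) *\<^sub>R D\<phi> x" for x
    using assms(1) by (intro GDERIV_DERIV_compose) (auto simp: test_function_def)
  have "1 + c * \<phi> x \<noteq> 0" for x using pos[of x] by linarith
  then show "continuous_on UNIV (\<lambda>x. (c / (1 + c * \<phi> x)\<^sup>2) *\<^sub>R D\<phi> x)"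
    using assms(1) test_function_continuous[OF assms(1)]
    by (intro continuous_intros) (auto simp: test_function_def)
qed auto

text \<open>
  Squaring makes the positive part differentiable at $0$ too. The error of the linear approximation is
  at most the squared increment, uniformly in the position of both points relative to $0$.
\<close>

lemma DERIV_positive_part_squared:
  "((\<lambda>s. (max 0 s)\<^sup>2) has_real_derivative 2 * max 0 s) (at s)" for s :: real
proof -
  have "((\<lambda>s. (max 0 s)\<^sup>2) has_derivative (\<lambda>h. 2 * max 0 s * h)) (at s)"
  proof (rule has_derivativeI_sandwich[where e = 1 and H = "\<lambda>y. norm (y - s)"])
    show "bounded_linear (\<lambda>h. 2 * max 0 s * h)"
      by (rule bounded_linear_mult_right)
    show "((\<lambda>y. norm (y - s)) \<longlongrightarrow> 0) (at s)"
      by (auto intro!: tendsto_eq_intros)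
    fix y :: real assume "y \<noteq> s"
    have "\<bar>(max 0 y)\<^sup>2 - (max 0 s)\<^sup>2 - 2 * max 0 s * (y - s)\<bar> \<le> (y - s)\<^sup>2"
    proof (cases "s \<ge> 0"; cases "y \<ge> 0")
      assume "s \<ge> 0" "y \<ge> 0"
      then have "(max 0 y)\<^sup>2 - (max 0 s)\<^sup>2 - 2 * max 0 s * (y - s) = (y - s)\<^sup>2"
        by (simp add: power2_eq_square algebra_simps)
      then show ?thesis by simp
    next
      assume h: "s \<ge> 0" "\<not> y \<ge> 0"
      then have "(max 0 y)\<^sup>2 - (max 0 s)\<^sup>2 - 2 * max 0 s * (y - s) = s\<^sup>2 - 2 * s * y"
        by (simp add: power2_eq_square algebra_simps)
      moreover have "s * y \<le> 0" using h by (simp add: mult_nonneg_nonpos)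
      moreover have "(y - s)\<^sup>2 = s\<^sup>2 - 2 * s * y + y\<^sup>2"
        by (simp add: power2_eq_square algebra_simps)
      moreover have "s\<^sup>2 \<ge> 0" "y\<^sup>2 \<ge> 0" by auto
      ultimately show ?thesis by linarith
    next
      assume "\<not> s \<ge> 0" "y \<ge> 0"
      then have "y\<^sup>2 \<le> (y - s)\<^sup>2" by (intro power_mono) auto
      with \<open>\<not> s \<ge> 0\<close> \<open>y \<ge> 0\<close> show ?thesis by simp
    qed auto
    then show "norm ((max 0 y)\<^sup>2 - (max 0 s)\<^sup>2 - 2 * max 0 s * (y - s)) / norm (y - s) \<le> norm (y - s)"
      using \<open>y \<noteq> s\<close> by (simp add: divide_le_eq power2_eq_square abs_mult_self_eq)
  qed auto
  then show ?thesis by (simp add: has_field_derivative_def)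
qed

text \<open>
  The polynomial $r^2 - |x - c|^2$ is positive exactly on the ball, and the square of its positive part
  is $C^1$ across the sphere.
\<close>

lemma test_function_ball:
  fixes c :: "real ^ 'n"
  assumes "r > 0"
  shows "\<exists>\<phi> D\<phi>. test_function \<phi> D\<phi> \<and> (\<forall>x. \<phi> x \<ge> 0) \<and> {x. \<phi> x \<noteq> 0} = ball c r"
proof -
  define g where "g = (\<lambda>x :: real ^ 'n. r\<^sup>2 - (x - c) \<bullet> (x - c))"
  let ?\<phi> = "\<lambda>x. (max 0 (g x))\<^sup>2" and ?D = "\<lambda>x. (2 * max 0 (g x)) *\<^sub>R (- 2 *\<^sub>R (x - c))"
  have "GDERIV g x :> - 2 *\<^sub>R (x - c)" for x
    unfolding g_def gderiv_def
    by (auto intro!: derivative_eq_intros simp: inner_simps inner_commute algebra_simps)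
  then have 1: "GDERIV ?\<phi> x :> ?D x" for x
    by (rule GDERIV_DERIV_compose) (rule DERIV_positive_part_squared)
  have 2: "continuous_on UNIV ?D"
    unfolding g_def by (intro continuous_intros)
  have supp: "{x. ?\<phi> x \<noteq> 0} = ball c r"
  proof -
    have "?\<phi> x \<noteq> 0 \<longleftrightarrow> dist c x < r" for x
    proof -
      have "?\<phi> x \<noteq> 0 \<longleftrightarrow> (x - c) \<bullet> (x - c) < r\<^sup>2"
        by (auto simp: g_def max_def)
      also have "\<dots> \<longleftrightarrow> norm (x - c) < r"
        using assms by (simp add: norm_lt_square)
      finally show ?thesis by (simp add: dist_norm norm_minus_commute)
    qed
    then show ?thesis unfolding ball_def by (intro Collect_cong)
  qed
  have "test_function ?\<phi> ?D"
  proof -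
    have "compact (closure {x. ?\<phi> x \<noteq> 0})"
      unfolding supp compact_closure by (rule bounded_ball)
    with 1 2 show ?thesis
      unfolding test_function_def by (intro conjI allI)
  qed
  with supp show ?thesis
    by (intro exI[of _ ?\<phi>] exI[of _ ?D] conjI allI) simp_all
qed

text \<open>
  An open set is a countable union of balls, so the partial sums $q_n$ of bump functions on these balls
  are test functions whose nonvanishing sets increase to it. The saturations $n q_n / (1 + n q_n)$ then
  converge to its indicator and are bounded by $1$, and dominated convergence applies.
\<close>

lemma integral_open_eq_zero_if_orthogonal:
  fixes h :: "real ^ 'n \<Rightarrow> real"
  assumes h: "integrable lborel h"
    and orth: "\<And>\<phi> D\<phi>. test_function \<phi> D\<phi> \<Longrightarrow> (\<integral>x. h x * \<phi> x \<partial>lborel) = 0"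
    and "open S"
  shows "(\<integral>x. h x * indicator S x \<partial>lborel) = 0"
proof (cases "S = {}")
  case False
  define \<F> where "\<F> = {ball c r | c r. r > 0 \<and> ball c r \<subseteq> S}"
  have "\<Union>\<F> = S"
    using \<open>open S\<close> unfolding \<F>_def open_contains_ball
    by (auto, metis centre_in_ball)
  moreover obtain \<F>' where "\<F>' \<subseteq> \<F>" "countable \<F>'" "\<Union>\<F>' = \<Union>\<F>"
    by (rule Lindelof[of \<F>]) (auto simp: \<F>_def)
  ultimately have \<F>': "\<Union>\<F>' = S" "\<F>' \<noteq> {}" "countable \<F>'"
    using False by auto
  then have range: "range (from_nat_into \<F>') = \<F>'"
    by (intro range_from_nat_into)
  have "\<exists>\<phi> D\<phi>. test_function \<phi> D\<phi> \<and> (\<forall>x. \<phi> x \<ge> 0) \<and> {x. \<phi> x \<noteq> 0} = from_nat_into \<F>' i" for i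
  proof -
    have "from_nat_into \<F>' i \<in> \<F>"
      using range \<open>\<F>' \<subseteq> \<F>\<close> by blast
    then obtain c r where "from_nat_into \<F>' i = ball c r" "r > 0"
      unfolding \<F>_def by blast
    then show ?thesis using test_function_ball[of r c] by simp
  qed
  then obtain \<phi> D\<phi> where \<phi>: "\<And>i. test_function (\<phi> i) (D\<phi> i)" "\<And>i x. \<phi> i x \<ge> 0"
      "\<And>i. {x. \<phi> i x \<noteq> 0} = from_nat_into \<F>' i"
    by metis
  have S_iff: "x \<in> S \<longleftrightarrow> (\<exists>i. \<phi> i x \<noteq> 0)" for x
  proof -
    have "x \<in> S \<longleftrightarrow> (\<exists>i. x \<in> from_nat_into \<F>' i)"
      using \<F>'(1) range by (metis UN_iff Union_iff rangeE rangeI)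
    then show ?thesis by (simp flip: \<phi>(3))
  qed
  define q where "q = (\<lambda>n x. \<Sum>i<n. \<phi> i x)"
  have q_nonneg: "q n x \<ge> 0" for n x
    unfolding q_def by (intro sum_nonneg \<phi>)
  define s where "s = (\<lambda>n x. real n * q n x / (1 + real n * q n x))"
  have s_test: "\<exists>D. test_function (s n) D" for n
    unfolding s_def
    using test_function_saturate[OF test_function_sum[of \<phi> D\<phi> n, OF \<phi>(1), folded q_def], of "real n"]
      q_nonneg[of n] by (intro exI) (simp add: q_def)
  have s_bound: "0 \<le> s n x" "s n x \<le> 1" for n x
    using q_nonneg[of n x] by (auto simp: s_def divide_simps add_pos_nonneg)
  have s_lim: "(\<lambda>n. s n x) \<longlonglongrightarrow> indicator S x" for x
  proof (cases "x \<in> S")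
    case True
    then obtain i where "\<phi> i x \<noteq> 0" using S_iff by blast
    then have pos: "\<phi> i x > 0" using \<phi>(2)[of i x] by linarith
    have "filterlim (\<lambda>n. real n * \<phi> i x) at_top sequentially"
      using pos by (intro filterlim_at_top_mult_tendsto_pos[where c = "\<phi> i x"] filterlim_real_sequentially)
        auto
    moreover have "eventually (\<lambda>n. real n * \<phi> i x \<le> 1 + real n * q n x) sequentially"
      using eventually_gt_at_top[of i]
    proof eventually_elim
      case (elim n)
      have "\<phi> i x \<le> q n x"
        unfolding q_def using elim \<phi>(2) by (intro member_le_sum) auto
      then show ?case using mult_left_mono[of "\<phi> i x" "q n x" "real n"] by simp
    qed
    ultimately have "filterlim (\<lambda>n. 1 + real n * q n x) at_top sequentially"
      by (rule filterlim_at_top_mono)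
    then have "(\<lambda>n. 1 - inverse (1 + real n * q n x)) \<longlonglongrightarrow> 1 - 0"
      by (intro tendsto_diff tendsto_const tendsto_inverse_0_at_top)
    moreover have "1 - inverse (1 + real n * q n x) = s n x" for n
      using q_nonneg[of n x] by (simp add: s_def field_simps add_pos_nonneg add_nonneg_eq_0_iff)
    ultimately show ?thesis using True by simp
  next
    case False
    then have "s n x = 0" for n
      using S_iff by (simp add: s_def q_def)
    then show ?thesis using False by simp
  qed
  have "(\<lambda>n. \<integral>x. h x * s n x \<partial>lborel) \<longlonglongrightarrow> (\<integral>x. h x * indicator S x \<partial>lborel)"
  proof (rule integral_dominated_convergence[where w = "\<lambda>x. norm (h x)"])
    show "(\<lambda>x. h x * indicator S x) \<in> borel_measurable lborel"
      using h \<open>open S\<close> by (intro borel_measurable_times borel_measurable_indicator) auto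
    show "(\<lambda>x. h x * s n x) \<in> borel_measurable lborel" for n
      using h s_test[of n] test_function_measurable[of "s n"] by auto
    show "integrable lborel (\<lambda>x. norm (h x))" using h by simp
    show "AE x in lborel. (\<lambda>n. h x * s n x) \<longlonglongrightarrow> h x * indicator S x"
      by (intro AE_I2 tendsto_intros s_lim)
    show "AE x in lborel. norm (h x * s n x) \<le> norm (h x)" for n
      using s_bound by (intro AE_I2) (simp add: abs_mult mult_left_le)
  qed
  moreover have "(\<integral>x. h x * s n x \<partial>lborel) = 0" for n
    using orth s_test by blast
  ultimately show ?thesis by (simp add: LIMSEQ_const_iff)
qed simp

text \<open>
  The sets over which $h$ has integral $0$ form a Dynkin system containing the open sets, which are
  stable under intersection and generate the Borel sets.
\<close>

lemma AE_zero_if_integrable_orthogonal: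
  fixes h :: "real ^ 'n \<Rightarrow> real"
  assumes h: "integrable lborel h"
    and orth: "\<And>\<phi> D\<phi>. test_function \<phi> D\<phi> \<Longrightarrow> (\<integral>x. h x * \<phi> x \<partial>lborel) = 0"
  shows "AE x in lborel. h x = 0"
proof (rule sigma_finite_measure.density_zero[OF sigma_finite_lborel h])
  have int: "set_integrable lborel A h" if "A \<in> sets lborel" for A
    unfolding set_integrable_def by (rule integrable_mult_indicator[OF that h])
  have op: "set_lebesgue_integral lborel S h = 0" if "open S" for S
    using integral_open_eq_zero_if_orthogonal[OF h orth that]
    by (simp add: set_lebesgue_integral_def mult.commute)
  fix A :: "(real ^ 'n) set" assume "A \<in> sets lborel"
  moreover have sets: "sigma_sets UNIV {S :: (real ^ 'n) set. open S} = sets lborel"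
    by (simp add: borel_def)
  ultimately have A: "A \<in> sigma_sets UNIV {S. open S}"
    by simp
  have "Int_stable {S :: (real ^ 'n) set. open S}" "{S :: (real ^ 'n) set. open S} \<subseteq> Pow UNIV"
    by (auto simp: Int_stable_def)
  from this A show "set_lebesgue_integral lborel A h = 0"
  proof (induction A rule: sigma_sets_induct_disjoint)
    case (compl A)
    have "set_lebesgue_integral lborel (A \<union> (UNIV - A)) h
        = set_lebesgue_integral lborel A h + set_lebesgue_integral lborel (UNIV - A) h"
      using compl sets by (intro set_integral_Un int) auto
    then show ?case using op[of UNIV] compl by (simp add: Un_absorb1)
  next
    case (union A)
    have "set_lebesgue_integral lborel (\<Union>i. A i) h = (\<Sum>i. set_lebesgue_integral lborel (A i) h)"
      using union sets by (intro lebesgue_integral_countable_add int) (auto simp: disjoint_family_on_def)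
    then show ?case using union by simp
  qed (auto simp: op)
qed

text \<open>
  A square-integrable function need not be integrable on a space of infinite measure. Multiplying it by
  a test function that is nonzero on a large ball makes it integrable and keeps the orthogonality, as
  products of test functions are test functions.
\<close>

lemma AE_zero_if_square_integrable_orthogonal:
  fixes g :: "real ^ 'n \<Rightarrow> real"
  assumes g: "square_integrable g"
    and orth: "\<And>\<phi> D\<phi>. test_function \<phi> D\<phi> \<Longrightarrow> (\<integral>x. g x * \<phi> x \<partial>lborel) = 0"
  shows "AE x in lborel. g x = 0"
proof -
  have "\<exists>\<phi> D\<phi>. test_function \<phi> D\<phi> \<and> (\<forall>x. \<phi> x \<ge> 0) \<and> {x. \<phi> x \<noteq> 0} = ball (0 :: real ^ 'n) (real (Suc k))" for k
    by (rule test_function_ball) simp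
  then obtain \<psi> D\<psi> where \<psi>: "\<And>k. test_function (\<psi> k) (D\<psi> k)"
      "\<And>k. {x. \<psi> k x \<noteq> 0} = ball (0 :: real ^ 'n) (real (Suc k))"
    by metis
  have "AE x in lborel. g x * \<psi> k x = 0" for k
  proof (rule AE_zero_if_integrable_orthogonal)
    show "integrable lborel (\<lambda>x. g x * \<psi> k x)"
      by (rule integrable_square_integrable_mult[OF g test_function_square_integrable[OF \<psi>(1)]])
    fix \<phi> D\<phi> assume "test_function \<phi> (D\<phi> :: real ^ 'n \<Rightarrow> real ^ 'n)"
    from orth[OF test_function_mult[OF \<psi>(1)[of k] this]]
    show "(\<integral>x. g x * \<psi> k x * \<phi> x \<partial>lborel) = 0" by (simp add: mult.assoc)
  qed
  then have "AE x in lborel. \<forall>k. g x * \<psi> k x = 0"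
    by (subst AE_all_countable) blast
  then show ?thesis
  proof eventually_elim
    case (elim x)
    obtain k where "norm x < real (Suc k)"
      by (metis reals_Archimedean2 lessI less_trans of_nat_less_iff)
    then have "\<psi> k x \<noteq> 0" using \<psi>(2)[of k] by (auto simp: set_eq_iff)
    then show ?case using elim by (metis mult_eq_0_iff)
  qed
qed

section \<open>Weak gradients under dilation\<close>

lemma integrable_dilate_iff:
  fixes f :: "'a :: euclidean_space \<Rightarrow> real"
  assumes "l > 0"
  shows "integrable lborel (\<lambda>x. f (l *\<^sub>R x)) \<longleftrightarrow> integrable lborel f"
proof -
  have imp: "integrable lborel (\<lambda>x. g (k *\<^sub>R x))"
    if g: "integrable lborel g" and "k > 0" for g :: "'a \<Rightarrow> real" and k
  proof -
    have [measurable]: "g \<in> borel_measurable borel" using g by auto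
    have "integrable (density (distr lborel borel (\<lambda>x. 0 + k *\<^sub>R x)) (\<lambda>_. \<bar>k\<bar> ^ DIM('a))) g"
      using \<open>k > 0\<close> by (intro subst[where P = "\<lambda>M. integrable M g", OF lborel_affine g]) auto
    then show ?thesis
      using \<open>k > 0\<close> by (simp add: integrable_density integrable_distr_eq)
  qed
  show ?thesis
    using imp[of f l] imp[of "\<lambda>x. f (l *\<^sub>R x)" "1 / l"] assms by auto
qed

lemma integral_dilate:
  fixes f :: "'a :: euclidean_space \<Rightarrow> real"
  assumes "l > 0"
  shows "(\<integral>x. f (l *\<^sub>R x) \<partial>lborel) = (\<integral>x. f x \<partial>lborel) / l ^ DIM('a)"
proof (cases "integrable lborel f")
  case True
  then have [measurable]: "f \<in> borel_measurable borel" by auto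
  have "(\<integral>x. f x \<partial>lborel) = l ^ DIM('a) * (\<integral>x. f (l *\<^sub>R x) \<partial>lborel)"
    using assms by (subst lborel_affine[of l 0]) (simp_all add: integral_density integral_distr)
  then show ?thesis using assms by simp
next
  case False
  then show ?thesis
    using integrable_dilate_iff[OF assms, of f] by (simp add: not_integrable_integral_eq)
qed

lemma measurable_dilate:
  fixes f :: "'a :: euclidean_space \<Rightarrow> 'b :: euclidean_space"
  assumes "f \<in> borel_measurable borel"
  shows "(\<lambda>x. f (l *\<^sub>R x)) \<in> borel_measurable borel"
proof (rule measurable_compose[of "\<lambda>x. l *\<^sub>R x" borel borel f borel])
  show "(\<lambda>x :: 'a. l *\<^sub>R x) \<in> borel \<rightarrow>\<^sub>M borel"
    by (rule borel_measurable_continuous_onI) (intro continuous_intros)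
qed (rule assms)

lemma test_function_dilate:
  fixes \<phi> :: "real ^ 'n \<Rightarrow> real"
  assumes "test_function \<phi> D\<phi>" and "l > 0"
  shows "test_function (\<lambda>x. \<phi> (l *\<^sub>R x)) (\<lambda>x. l *\<^sub>R D\<phi> (l *\<^sub>R x))"
proof -
  have "GDERIV (\<lambda>x. \<phi> (l *\<^sub>R x)) x :> l *\<^sub>R D\<phi> (l *\<^sub>R x)" for x
  proof -
    have "(\<phi> has_derivative (\<lambda>h. h \<bullet> D\<phi> (l *\<^sub>R x))) (at (l *\<^sub>R x))"
      using assms(1) by (simp add: test_function_def gderiv_def)
    moreover have "((\<lambda>x. l *\<^sub>R x) has_derivative (\<lambda>h. l *\<^sub>R h)) (at x)"
      by (intro has_derivative_scaleR_right has_derivative_ident)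
    ultimately have "((\<lambda>x. \<phi> (l *\<^sub>R x)) has_derivative (\<lambda>h. (l *\<^sub>R h) \<bullet> D\<phi> (l *\<^sub>R x))) (at x)"
      by (rule has_derivative_compose[rotated])
    then show ?thesis
      by (simp add: gderiv_def)
  qed
  moreover have "continuous_on UNIV (\<lambda>x. l *\<^sub>R D\<phi> (l *\<^sub>R x))"
  proof (rule continuous_on_scaleR[OF continuous_on_const continuous_on_compose2[of UNIV D\<phi> UNIV "\<lambda>x. l *\<^sub>R x"]])
    show "continuous_on UNIV D\<phi>"
      using assms(1) by (simp add: test_function_def)
    show "continuous_on UNIV (\<lambda>x :: real ^ 'n. l *\<^sub>R x)"
      by (intro continuous_intros)
  qed simp
  moreover have "bounded {x. \<phi> (l *\<^sub>R x) \<noteq> 0}"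
  proof -
    have "bounded ((\<lambda>x. (1 / l) *\<^sub>R x) ` {x. \<phi> x \<noteq> 0})"
      using assms(1) by (intro bounded_scaling) (simp add: test_function_def compact_closure)
    moreover have "{x. \<phi> (l *\<^sub>R x) \<noteq> 0} \<subseteq> (\<lambda>x. (1 / l) *\<^sub>R x) ` {x. \<phi> x \<noteq> 0}"
    proof
      fix x assume "x \<in> {x. \<phi> (l *\<^sub>R x) \<noteq> 0}"
      then show "x \<in> (\<lambda>x. (1 / l) *\<^sub>R x) ` {x. \<phi> x \<noteq> 0}"
        using assms(2) by (intro image_eqI[of _ _ "l *\<^sub>R x"]) auto
    qed
    ultimately show ?thesis by (rule bounded_subset)
  qed
  ultimately show ?thesis
    unfolding test_function_def compact_closure by (intro conjI allI)
qed

text \<open>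
  The dilation is moved from $u$ to the test function by a change of variables, which turns the identity
  to be shown into the one for $u$ and the inversely dilated test function.
\<close>

lemma is_weak_gradient_dilate:
  fixes u :: "real ^ 'n \<Rightarrow> real"
  assumes "is_weak_gradient u G" and "l > 0"
  shows "is_weak_gradient (\<lambda>x. c * u (l *\<^sub>R x)) (\<lambda>x. (c * l) *\<^sub>R G (l *\<^sub>R x))"
  unfolding is_weak_gradient_def
proof (intro allI impI)
  fix \<phi> D\<phi> and i :: 'n
  assume "test_function \<phi> (D\<phi> :: real ^ 'n \<Rightarrow> real ^ 'n)"
  then have test: "test_function (\<lambda>x. \<phi> ((1 / l) *\<^sub>R x)) (\<lambda>x. (1 / l) *\<^sub>R D\<phi> ((1 / l) *\<^sub>R x))"
    using assms(2) by (intro test_function_dilate) auto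
  define \<psi> where "\<psi> = (\<lambda>x. \<phi> ((1 / l) *\<^sub>R x))"
  define D\<psi> where "D\<psi> = (\<lambda>x. (1 / l) *\<^sub>R D\<phi> ((1 / l) *\<^sub>R x))"
  have \<phi>: "\<phi> x = \<psi> (l *\<^sub>R x)" "D\<phi> x $ i = l * D\<psi> (l *\<^sub>R x) $ i" for x
    using assms(2) by (simp_all add: \<psi>_def D\<psi>_def)
  define f where "f = (\<lambda>x. u x * D\<psi> x $ i)"
  define g where "g = (\<lambda>x. G x $ i * \<psi> x)"
  have eq: "(\<integral>x. f x \<partial>lborel) = - (\<integral>x. g x \<partial>lborel)"
    using assms(1)[unfolded is_weak_gradient_def, rule_format, OF test]
    unfolding f_def g_def \<psi>_def D\<psi>_def .
  have "(\<integral>x. c * u (l *\<^sub>R x) * D\<phi> x $ i \<partial>lborel) = (\<integral>x. c * l * f (l *\<^sub>R x) \<partial>lborel)"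
    by (simp only: f_def \<phi> ac_simps)
  also have "\<dots> = c * l * ((\<integral>x. f x \<partial>lborel) / l ^ CARD('n))"
    using integral_dilate[OF assms(2), of f] by simp
  also have "\<dots> = - (c * l * ((\<integral>x. g x \<partial>lborel) / l ^ CARD('n)))"
    unfolding eq by simp
  also have "\<dots> = - (\<integral>x. c * l * g (l *\<^sub>R x) \<partial>lborel)"
    using integral_dilate[OF assms(2), of g] by simp
  also have "\<dots> = - (\<integral>x. ((c * l) *\<^sub>R G (l *\<^sub>R x)) $ i * \<phi> x \<partial>lborel)"
    by (simp only: g_def \<phi> vector_scaleR_component real_scaleR_def mult.assoc)
  finally show "(\<integral>x. c * u (l *\<^sub>R x) * D\<phi> x $ i \<partial>lborel)
      = - (\<integral>x. ((c * l) *\<^sub>R G (l *\<^sub>R x)) $ i * \<phi> x \<partial>lborel)" .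
qed

lemma square_integrable_dilate:
  fixes f :: "real ^ 'n \<Rightarrow> 'b :: euclidean_space"
  assumes "square_integrable f" and "l > 0"
  shows "square_integrable (\<lambda>x. c *\<^sub>R f (l *\<^sub>R x))"
proof -
  have "integrable lborel (\<lambda>x. (norm (f (l *\<^sub>R x)))\<^sup>2)"
    using assms integrable_dilate_iff[of l "\<lambda>x. (norm (f x))\<^sup>2"] by (simp add: square_integrable_def)
  moreover have "(\<lambda>x. f (l *\<^sub>R x)) \<in> borel_measurable borel"
    using assms(1) by (intro measurable_dilate) (simp add: square_integrable_def)
  ultimately show ?thesis
    by (simp add: square_integrable_def power_mult_distrib)
qed

lemma square_integrable_component:
  fixes G :: "real ^ 'n \<Rightarrow> real ^ 'n"
  assumes "square_integrable G"
  shows "square_integrable (\<lambda>x. G x $ i)"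
proof -
  have "G \<in> borel_measurable borel"
    using assms by (simp add: square_integrable_def)
  moreover have "(\<lambda>v :: real ^ 'n. v $ i) \<in> borel_measurable borel"
    by (intro borel_measurable_continuous_onI linear_continuous_on bounded_linear_vec_nth)
  ultimately have meas [measurable]: "(\<lambda>x. G x $ i) \<in> borel_measurable borel"
    by (rule measurable_compose)
  have "integrable lborel (\<lambda>x. (norm (G x))\<^sup>2)"
    using assms by (simp add: square_integrable_def)
  then have "integrable lborel (\<lambda>x. (G x $ i)\<^sup>2)"
  proof (rule Bochner_Integration.integrable_bound)
    show "AE x in lborel. norm ((G x $ i)\<^sup>2) \<le> norm ((norm (G x))\<^sup>2)"
      using component_le_norm_cart[of "G _" i] by (intro AE_I2) (simp add: abs_le_square_iff[symmetric])
  qed measurable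
  then show ?thesis using meas by (simp add: square_integrable_def)
qed

lemma square_integrable_diff:
  fixes f g :: "real ^ 'n \<Rightarrow> real"
  assumes "square_integrable f" and "square_integrable g"
  shows "square_integrable (\<lambda>x. f x - g x)"
proof -
  have "integrable lborel (\<lambda>x. (f x)\<^sup>2 + (g x)\<^sup>2 - 2 * (f x * g x))"
    using assms integrable_square_integrable_mult[OF assms]
    by (intro Bochner_Integration.integrable_diff Bochner_Integration.integrable_add
        integrable_mult_right) (auto simp: square_integrable_def)
  then have "integrable lborel (\<lambda>x. (f x - g x)\<^sup>2)"
    by (simp add: power2_diff mult.assoc)
  then show ?thesis
    using assms by (auto simp: square_integrable_def)
qed

lemma weak_gradient_unique:
  fixes u :: "real ^ 'n \<Rightarrow> real"
  assumes G: "square_integrable G" "is_weak_gradient u G"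
    and G': "square_integrable G'" "is_weak_gradient u G'"
  shows "AE x in lborel. G x = G' x"
proof -
  have "AE x in lborel. G x $ i - G' x $ i = 0" for i
  proof (rule AE_zero_if_square_integrable_orthogonal)
    note si = square_integrable_component[OF G(1), of i] square_integrable_component[OF G'(1), of i]
    show "square_integrable (\<lambda>x. G x $ i - G' x $ i)"
      by (rule square_integrable_diff[OF si])
    fix \<phi> D\<phi> assume \<phi>: "test_function \<phi> (D\<phi> :: real ^ 'n \<Rightarrow> real ^ 'n)"
    from si test_function_square_integrable[OF \<phi>] have "integrable lborel (\<lambda>x. G x $ i * \<phi> x)" "integrable lborel (\<lambda>x. G' x $ i * \<phi> x)"
      by (auto intro: integrable_square_integrable_mult)
    then have "(\<integral>x. (G x $ i - G' x $ i) * \<phi> x \<partial>lborel)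
        = (\<integral>x. G x $ i * \<phi> x \<partial>lborel) - (\<integral>x. G' x $ i * \<phi> x \<partial>lborel)"
      by (simp add: left_diff_distrib)
    also have "\<dots> = 0"
    proof -
      have "(\<integral>x. u x * D\<phi> x $ i \<partial>lborel) = - (\<integral>x. G x $ i * \<phi> x \<partial>lborel)"
        "(\<integral>x. u x * D\<phi> x $ i \<partial>lborel) = - (\<integral>x. G' x $ i * \<phi> x \<partial>lborel)"
        using G(2) G'(2) \<phi> unfolding is_weak_gradient_def by blast+
      then show ?thesis by linarith
    qed
    finally show "(\<integral>x. (G x $ i - G' x $ i) * \<phi> x \<partial>lborel) = 0" .
  qed
  then have "AE x in lborel. \<forall>i. G x $ i - G' x $ i = 0"
    by (subst AE_all_countable) blast
  then show ?thesis
    by eventually_elim (simp add: vec_eq_iff)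
qed

lemma H1_weak_gradient:
  assumes "u \<in> H1"
  shows "square_integrable (weak_gradient u)" and "is_weak_gradient u (weak_gradient u)"
proof -
  have "\<exists>G. square_integrable G \<and> is_weak_gradient u G"
    using assms by (simp add: H1_def)
  from someI_ex[OF this]
  show "square_integrable (weak_gradient u)" and "is_weak_gradient u (weak_gradient u)"
    unfolding weak_gradient_def by blast+
qed

lemma
  fixes u :: "real ^ 'n \<Rightarrow> real"
  assumes u: "u \<in> H1" and "l > 0"
  shows H1_dilate: "(\<lambda>x. c * u (l *\<^sub>R x)) \<in> H1"
    and weak_gradient_dilate:
      "AE x in lborel. weak_gradient (\<lambda>x. c * u (l *\<^sub>R x)) x = (c * l) *\<^sub>R weak_gradient u (l *\<^sub>R x)"
proof -
  note grad = square_integrable_dilate[OF H1_weak_gradient(1)[OF u] \<open>l > 0\<close>, of "c * l"]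
    is_weak_gradient_dilate[OF H1_weak_gradient(2)[OF u] \<open>l > 0\<close>, of c]
  have "square_integrable (\<lambda>x. c *\<^sub>R u (l *\<^sub>R x))"
    using u \<open>l > 0\<close> by (intro square_integrable_dilate) (auto simp: H1_def)
  with grad show H1: "(\<lambda>x. c * u (l *\<^sub>R x)) \<in> H1"
    unfolding H1_def real_scaleR_def by blast
  show "AE x in lborel. weak_gradient (\<lambda>x. c * u (l *\<^sub>R x)) x = (c * l) *\<^sub>R weak_gradient u (l *\<^sub>R x)"
    by (rule weak_gradient_unique[OF H1_weak_gradient[OF H1] grad])
qed

section \<open>Energy levels of ground states\<close>

lemma H1_measurable:
  assumes "u \<in> H1"
  shows "u \<in> borel_measurable borel" and "weak_gradient u \<in> borel_measurable borel"
  using assms H1_weak_gradient(1)[OF assms] by (simp_all add: H1_def square_integrable_def)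

text \<open>
  The parameter $\alpha$ is scaled by $l^2$ because each derivative produces one factor $l$; then both parts
  of the energy form scale alike. Setting $u = v$ gives the squared norm, and keeping $v$ general
  gives the weak formulation of the rescaled equation.
\<close>

lemma inner_integral_dilate:
  fixes u v :: "real ^ 'n \<Rightarrow> real"
  assumes u: "u \<in> H1" and v: "v \<in> H1" and "l > 0"
  shows "(\<integral>x. weak_gradient (\<lambda>x. c * u (l *\<^sub>R x)) x \<bullet> weak_gradient (\<lambda>x. d * v (l *\<^sub>R x)) x
            + l\<^sup>2 * \<alpha> * (c * u (l *\<^sub>R x)) * (d * v (l *\<^sub>R x)) \<partial>lborel)
       = c * d * l\<^sup>2 / l ^ CARD('n)
            * (\<integral>x. weak_gradient u x \<bullet> weak_gradient v x + \<alpha> * u x * v x \<partial>lborel)"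
    (is "?L = _ * (\<integral>x. ?f x \<partial>lborel)")
proof -
  note meas [measurable] = H1_measurable[OF u] H1_measurable[OF v]
    H1_measurable[OF H1_dilate[OF u \<open>l > 0\<close>, of c]] H1_measurable[OF H1_dilate[OF v \<open>l > 0\<close>, of d]]
  have f: "?f \<in> borel_measurable borel"
    by measurable
  have "?L = (\<integral>x. c * d * l\<^sup>2 * ?f (l *\<^sub>R x) \<partial>lborel)"
  proof (rule integral_cong_AE)
    show "(\<lambda>x. weak_gradient (\<lambda>x. c * u (l *\<^sub>R x)) x \<bullet> weak_gradient (\<lambda>x. d * v (l *\<^sub>R x)) x
            + l\<^sup>2 * \<alpha> * (c * u (l *\<^sub>R x)) * (d * v (l *\<^sub>R x))) \<in> borel_measurable lborel"
      unfolding measurable_lborel2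
      by (intro borel_measurable_add borel_measurable_inner borel_measurable_times
          borel_measurable_const meas)
    show "(\<lambda>x. c * d * l\<^sup>2 * ?f (l *\<^sub>R x)) \<in> borel_measurable lborel"
      unfolding measurable_lborel2
      by (intro borel_measurable_times borel_measurable_const measurable_dilate[OF f])
    show "AE x in lborel. weak_gradient (\<lambda>x. c * u (l *\<^sub>R x)) x \<bullet> weak_gradient (\<lambda>x. d * v (l *\<^sub>R x)) x
            + l\<^sup>2 * \<alpha> * (c * u (l *\<^sub>R x)) * (d * v (l *\<^sub>R x)) = c * d * l\<^sup>2 * ?f (l *\<^sub>R x)"
      using weak_gradient_dilate[OF u \<open>l > 0\<close>, of c] weak_gradient_dilate[OF v \<open>l > 0\<close>, of d]
      by eventually_elim (simp add: power2_eq_square algebra_simps)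
  qed
  also have "\<dots> = c * d * l\<^sup>2 * ((\<integral>x. ?f x \<partial>lborel) / l ^ CARD('n))"
    using integral_dilate[OF \<open>l > 0\<close>, of ?f] by simp
  finally show ?thesis by simp
qed

lemma H1_norm_sq_eq_inner:
  "H1_norm_sq \<alpha> u = (\<integral>x. weak_gradient u x \<bullet> weak_gradient u x + \<alpha> * u x * u x \<partial>lborel)"
  unfolding H1_norm_sq_def power2_norm_eq_inner by (simp add: power2_eq_square mult.assoc)

lemma H1_norm_sq_dilate:
  fixes u :: "real ^ 'n \<Rightarrow> real"
  assumes "u \<in> H1" and "l > 0"
  shows "H1_norm_sq (l\<^sup>2 * \<alpha>) (\<lambda>x. c * u (l *\<^sub>R x)) = c\<^sup>2 * l\<^sup>2 / l ^ CARD('n) * H1_norm_sq \<alpha> u"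
  unfolding H1_norm_sq_eq_inner inner_integral_dilate[OF assms(1,1,2)]
  by (simp add: power2_eq_square)

lemma H1_norm_sq_mult:
  fixes u :: "real ^ 'n \<Rightarrow> real"
  assumes "u \<in> H1"
  shows "H1_norm_sq \<alpha> (\<lambda>x. c * u x) = c\<^sup>2 * H1_norm_sq \<alpha> u"
  using H1_norm_sq_dilate[OF assms, of 1 \<alpha> c] by simp

text \<open>
  Any test function $v \in H^1$ is itself a dilation, $v(x) = z(lx)$ with $z \in H^1$, so both sides of the
  weak formulation reduce to those for $u$ tested with $z$. The condition on $b'$ balances the
  factor $c\,l^2$ on the left against $c^{2p-1}$ on the right.
\<close>

lemma weak_solution_dilate:
  fixes u :: "real ^ 'n \<Rightarrow> real"
  assumes u: "weak_solution p \<alpha> b u" and "l > 0" and "c > 0"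
    and b': "(1 + b') * c powr (2 * p - 2) = (1 + b) * l\<^sup>2"
  shows "weak_solution p (l\<^sup>2 * \<alpha>) b' (\<lambda>x. c * u (l *\<^sub>R x))"
proof -
  have uH: "u \<in> H1" using u by (simp add: weak_solution_def)
  have "(\<integral>x. weak_gradient (\<lambda>x. c * u (l *\<^sub>R x)) x \<bullet> weak_gradient v x
            + l\<^sup>2 * \<alpha> * (c * u (l *\<^sub>R x)) * v x \<partial>lborel)
      = (1 + b') * (\<integral>x. \<bar>c * u (l *\<^sub>R x)\<bar> powr (2 * p - 2) * (c * u (l *\<^sub>R x)) * v x \<partial>lborel)"
    if v: "v \<in> H1" for v
  proof -
    define z where "z = (\<lambda>x. 1 * v ((1 / l) *\<^sub>R x))"
    have z: "z \<in> H1" unfolding z_def using v \<open>l > 0\<close> by (intro H1_dilate) auto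
    have vz: "1 * z (l *\<^sub>R x) = v x" for x
      using \<open>l > 0\<close> by (simp add: z_def)
    define f where "f = (\<lambda>x. \<bar>u x\<bar> powr (2 * p - 2) * u x * z x)"
    have "(\<integral>x. weak_gradient (\<lambda>x. c * u (l *\<^sub>R x)) x \<bullet> weak_gradient v x
            + l\<^sup>2 * \<alpha> * (c * u (l *\<^sub>R x)) * v x \<partial>lborel)
        = c * 1 * l\<^sup>2 / l ^ CARD('n)
            * (\<integral>x. weak_gradient u x \<bullet> weak_gradient z x + \<alpha> * u x * z x \<partial>lborel)"
      using inner_integral_dilate[OF uH z \<open>l > 0\<close>, of c 1 \<alpha>] unfolding vz .
    also have "\<dots> = c * 1 * l\<^sup>2 / l ^ CARD('n) * ((1 + b) * (\<integral>x. f x \<partial>lborel))"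
      unfolding f_def
      using u[unfolded weak_solution_def, THEN conjunct2, rule_format, OF z] by (rule arg_cong)
    also have "\<dots> = c * ((1 + b) * l\<^sup>2) * ((\<integral>x. f x \<partial>lborel) / l ^ CARD('n))"
      by simp
    also have "\<dots> = c * ((1 + b) * l\<^sup>2) * (\<integral>x. f (l *\<^sub>R x) \<partial>lborel)"
      using integral_dilate[OF \<open>l > 0\<close>, of f] by simp
    also have "\<dots> = (1 + b') * (c powr (2 * p - 2) * c * (\<integral>x. f (l *\<^sub>R x) \<partial>lborel))"
      unfolding b'[symmetric] by simp
    also have "\<dots> = (1 + b') * (\<integral>x. c powr (2 * p - 2) * c * f (l *\<^sub>R x) \<partial>lborel)"
      by simp
    also have "(\<lambda>x. c powr (2 * p - 2) * c * f (l *\<^sub>R x))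
        = (\<lambda>x. \<bar>c * u (l *\<^sub>R x)\<bar> powr (2 * p - 2) * (c * u (l *\<^sub>R x)) * v x)"
      using \<open>c > 0\<close> by (simp add: f_def abs_mult powr_mult mult_ac flip: vz)
    finally show ?thesis .
  qed
  then show ?thesis
    using H1_dilate[OF uH \<open>l > 0\<close>, of c] unfolding weak_solution_def by blast
qed

lemma Lq_norm_powr:
  assumes "q > 0"
  shows "Lq_norm q u powr q = (\<integral>x. \<bar>u x\<bar> powr q \<partial>lborel)"
  using assms by (simp add: Lq_norm_def powr_powr)

text \<open>
  Testing the equation with $u$ itself shows $\|u\|_\alpha^2 = (1 + b)\int |u|^{2p}$, where the left-hand side
  is positive. The integral of a function that is not integrable has the default value $0$, so the
  identity forces $|u|^{2p}$ to be integrable.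
\<close>

lemma
  fixes u :: "real ^ 'n \<Rightarrow> real"
  assumes u: "weak_solution p \<alpha> b u" and nontrivial: "\<not> (AE x in lborel. u x = 0)"
    and "\<alpha> > 0"
  shows weak_solution_norm_pos: "H1_norm_sq \<alpha> u > 0"
    and weak_solution_energy: "H1_norm_sq \<alpha> u = (1 + b) * (\<integral>x. \<bar>u x\<bar> powr (2 * p) \<partial>lborel)"
    and weak_solution_integrable: "integrable lborel (\<lambda>x. \<bar>u x\<bar> powr (2 * p))"
proof -
  have uH: "u \<in> H1" using u by (simp add: weak_solution_def)
  have int: "integrable lborel (\<lambda>x. (norm (weak_gradient u x))\<^sup>2)" "integrable lborel (\<lambda>x. (u x)\<^sup>2)"
    using H1_weak_gradient(1)[OF uH] uH by (simp_all add: square_integrable_def H1_def)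
  have "(\<integral>x. (u x)\<^sup>2 \<partial>lborel) \<noteq> 0"
    using nontrivial int(2) by (simp add: integral_nonneg_eq_0_iff_AE)
  then have "(\<integral>x. (u x)\<^sup>2 \<partial>lborel) > 0"
    by (simp add: less_le)
  moreover have "H1_norm_sq \<alpha> u
      = (\<integral>x. (norm (weak_gradient u x))\<^sup>2 \<partial>lborel) + \<alpha> * (\<integral>x. (u x)\<^sup>2 \<partial>lborel)"
    using int by (simp add: H1_norm_sq_def)
  moreover have "(\<integral>x. (norm (weak_gradient u x))\<^sup>2 \<partial>lborel) \<ge> 0"
    by simp
  ultimately show pos: "H1_norm_sq \<alpha> u > 0"
    using \<open>\<alpha> > 0\<close> by (simp add: add_nonneg_pos)
  have "\<bar>t\<bar> powr (2 * p - 2) * t * t = \<bar>t\<bar> powr (2 * p)" for t :: real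
  proof (cases "t = 0")
    case False
    have "\<bar>t\<bar> powr (2 * p) = \<bar>t\<bar> powr (2 * p - 2) * \<bar>t\<bar> powr 2"
      using powr_add[of "\<bar>t\<bar>" "2 * p - 2" 2] by simp
    also have "\<bar>t\<bar> powr 2 = t * t"
      using False by (simp add: powr_numeral power2_eq_square)
    finally show ?thesis by simp
  qed simp
  then show energy: "H1_norm_sq \<alpha> u = (1 + b) * (\<integral>x. \<bar>u x\<bar> powr (2 * p) \<partial>lborel)"
    using u[unfolded weak_solution_def, THEN conjunct2, rule_format, OF uH]
    unfolding H1_norm_sq_eq_inner by simp
  show "integrable lborel (\<lambda>x. \<bar>u x\<bar> powr (2 * p))"
  proof (rule ccontr)
    assume "\<not> integrable lborel (\<lambda>x. \<bar>u x\<bar> powr (2 * p))"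
    then show False using pos energy by (simp add: not_integrable_integral_eq)
  qed
qed

text \<open>
  On solutions the nonlinear term of the energy is a multiple of the quadratic one, by
  \<open>weak_solution_energy\<close>; so levels scale like squared norms.
\<close>

lemma J_scalar_weak_solution:
  fixes u :: "real ^ 'n \<Rightarrow> real"
  assumes "weak_solution p \<alpha> b u" and "\<not> (AE x in lborel. u x = 0)" and "\<alpha> > 0" and "p > 0"
  shows "J_scalar p \<alpha> b u = (1 / 2 - 1 / (2 * p)) * H1_norm_sq \<alpha> u"
proof -
  have "J_scalar p \<alpha> b u = 1 / 2 * H1_norm_sq \<alpha> u
      - 1 / (2 * p) * ((1 + b) * (\<integral>x. \<bar>u x\<bar> powr (2 * p) \<partial>lborel))"
    using \<open>p > 0\<close> by (simp add: J_scalar_def Lq_norm_powr)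
  then show ?thesis
    unfolding weak_solution_energy[OF assms(1-3), symmetric] by (simp add: algebra_simps)
qed

lemma positive_not_AE_zero:
  fixes u :: "real ^ 'n \<Rightarrow> real"
  assumes "\<And>x. u x > 0"
  shows "\<not> (AE x in lborel. u x = 0)"
proof
  assume "AE x in lborel. u x = 0"
  then have "AE x in (lborel :: (real ^ 'n) measure). False"
    using assms by (auto elim!: eventually_mono simp: less_le)
  then show False
    by (simp add: AE_iff_null null_sets_def)
qed

text \<open>
  A dilation of $u$ solves the equation for $(\alpha', b')$, so its energy is an upper bound for the
  ground state level there. The dilation is determined by $l^2 = \alpha'/\alpha$ and
  $(1 + b')\,c^{2p-2} = (1 + b)\,l^2$.
\<close>

lemma ground_state_level_le:
  fixes u u' :: "real ^ 'n \<Rightarrow> real"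
  assumes u: "ground_state p \<alpha> b u" and u': "ground_state p \<alpha>' b' u'"
    and p: "p > 1" and pos: "\<alpha> > 0" "\<alpha>' > 0" "b \<ge> 0" "b' \<ge> 0"
  shows "J_scalar p \<alpha>' b' u' \<le> ((1 + b') / (1 + b)) powr (- (1 / (p - 1)))
           * (\<alpha>' / \<alpha>) powr (p / (p - 1) - real CARD('n) / 2) * J_scalar p \<alpha> b u"
proof -
  define r where "r = \<alpha>' / \<alpha>"
  define l where "l = sqrt r"
  define m where "m = (1 + b') / (1 + b)"
  define c where "c = (r / m) powr (1 / (2 * p - 2))"
  have rm: "r > 0" "m > 0" using pos by (simp_all add: r_def m_def)
  then have l: "l > 0" "l\<^sup>2 = r" and c: "c > 0" by (simp_all add: l_def c_def)
  have \<alpha>': "l\<^sup>2 * \<alpha> = \<alpha>'" using pos l by (simp add: r_def)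
  have "c powr (2 * p - 2) = r / m"
    using p rm by (simp add: c_def powr_powr)
  moreover have "(1 + b') * (r / m) = (1 + b) * r"
  proof -
    have "1 + b \<noteq> 0" "1 + b' \<noteq> 0" using pos by linarith+
    then have "1 + b' = (1 + b) * m" by (simp add: m_def)
    then show ?thesis using rm by simp
  qed
  ultimately have b': "(1 + b') * c powr (2 * p - 2) = (1 + b) * l\<^sup>2"
    unfolding l(2) by (simp only:)
  let ?v = "\<lambda>x. c * u (l *\<^sub>R x)"
  have upos: "\<And>x. u x > 0" using u unfolding ground_state_def by blast
  have sol: "weak_solution p \<alpha> b u" using u unfolding ground_state_def by blast
  have nz: "\<not> (AE x in lborel. u x = 0)" "\<not> (AE x in lborel. ?v x = 0)"
    using upos c by (intro positive_not_AE_zero; simp)+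
  have v: "weak_solution p \<alpha>' b' ?v"
    using weak_solution_dilate[OF sol l(1) c b'] by (simp add: \<alpha>')
  have "J_scalar p \<alpha>' b' u' \<le> J_scalar p \<alpha>' b' ?v"
    using u' v nz(2) unfolding ground_state_def by blast
  also have "\<dots> = (1 / 2 - 1 / (2 * p)) * H1_norm_sq (l\<^sup>2 * \<alpha>) ?v"
    unfolding \<alpha>' using p pos by (intro J_scalar_weak_solution v nz) auto
  also have "\<dots> = (1 / 2 - 1 / (2 * p)) * (c\<^sup>2 * l\<^sup>2 / l ^ CARD('n) * H1_norm_sq \<alpha> u)"
    using sol by (subst H1_norm_sq_dilate[OF _ l(1)]) (auto simp: weak_solution_def)
  also have "\<dots> = c\<^sup>2 * l\<^sup>2 / l ^ CARD('n) * J_scalar p \<alpha> b u"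
    using p pos by (subst J_scalar_weak_solution[OF sol nz(1)]) auto
  also have "c\<^sup>2 * l\<^sup>2 / l ^ CARD('n)
      = m powr (- (1 / (p - 1))) * r powr (p / (p - 1) - real CARD('n) / 2)"
  proof -
    have "c\<^sup>2 = c powr 2" using c by simp
    also have "\<dots> = (r / m) powr (1 / (p - 1))"
    proof -
      have "1 / (2 * p - 2) * 2 = 1 / (p - 1)" using p by (simp add: field_simps)
      then show ?thesis by (simp only: c_def powr_powr)
    qed
    also have "\<dots> = r powr (1 / (p - 1)) * m powr (- (1 / (p - 1)))"
      using rm by (simp add: powr_divide powr_minus_divide)
    finally have c2: "c\<^sup>2 = r powr (1 / (p - 1)) * m powr (- (1 / (p - 1)))" .
    have "l ^ CARD('n) = (r powr (1 / 2)) powr real CARD('n)"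
      using l(1) rm by (simp add: powr_realpow l_def powr_half_sqrt)
    then have lN: "l ^ CARD('n) = r powr (real CARD('n) / 2)"
      by (simp add: powr_powr)
    have "p / (p - 1) = 1 / (p - 1) + 1" using p by (simp add: field_simps)
    then have "r powr (p / (p - 1) - real CARD('n) / 2)
        = r powr (1 / (p - 1)) * r / r powr (real CARD('n) / 2)"
      using rm by (simp add: powr_diff powr_add)
    then show ?thesis unfolding c2 lN l(2) by simp
  qed
  finally show ?thesis by (simp add: r_def m_def)
qed

text \<open>
  The two inequalities obtained by exchanging the roles of $u$ and $u'$ have reciprocal factors.
\<close>

lemma ground_state_level:
  fixes u u' :: "real ^ 'n \<Rightarrow> real"
  assumes u: "ground_state p \<alpha> b u" and u': "ground_state p \<alpha>' b' u'"
    and p: "p > 1" and pos: "\<alpha> > 0" "\<alpha>' > 0" "b \<ge> 0" "b' \<ge> 0"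
  shows "J_scalar p \<alpha>' b' u' = ((1 + b') / (1 + b)) powr (- (1 / (p - 1)))
           * (\<alpha>' / \<alpha>) powr (p / (p - 1) - real CARD('n) / 2) * J_scalar p \<alpha> b u"
proof (rule antisym)
  let ?e = "- (1 / (p - 1))" and ?g = "p / (p - 1) - real CARD('n) / 2"
  show "J_scalar p \<alpha>' b' u' \<le> ((1 + b') / (1 + b)) powr ?e * (\<alpha>' / \<alpha>) powr ?g * J_scalar p \<alpha> b u"
    by (rule ground_state_level_le[OF assms])
  let ?F = "((1 + b') / (1 + b)) powr ?e * (\<alpha>' / \<alpha>) powr ?g"
  have F: "?F > 0" using pos by simp
  have "J_scalar p \<alpha> b u
      \<le> ((1 + b) / (1 + b')) powr ?e * (\<alpha> / \<alpha>') powr ?g * J_scalar p \<alpha>' b' u'"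
    by (rule ground_state_level_le[OF u' u p pos(2,1,4,3)])
  also have "((1 + b) / (1 + b')) powr ?e * (\<alpha> / \<alpha>') powr ?g = 1 / ?F"
    using pos by (simp add: powr_divide field_simps)
  finally show "?F * J_scalar p \<alpha> b u \<le> J_scalar p \<alpha>' b' u'"
    using F by (simp add: field_simps)
qed

section \<open>The coupled maximum lies strictly below the uncoupled levels\<close>

text \<open>
  Young's inequality for $t^2 = (t^2 q^{-1/p})\,q^{1/p}$ with the conjugate exponents $p$ and $p/(p-1)$.
  The bound is the maximum of the profile; it is attained at $t = q^{1/(2p-2)}$.
\<close>

lemma dilation_profile_le:
  fixes p q t :: real
  assumes "p > 1" and "q > 0" and "t \<ge> 0"
  shows "t\<^sup>2 / 2 - t powr (2 * p) / (2 * p * q) \<le> (1 / 2 - 1 / (2 * p)) * q powr (1 / (p - 1))"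
proof -
  define r where "r = p / (p - 1)"
  have r: "r > 1" "1 / p + 1 / r = 1"
    using \<open>p > 1\<close> by (auto simp: r_def field_simps)
  have "t\<^sup>2 / q powr (1 / p) * q powr (1 / p)
      \<le> (t\<^sup>2 / q powr (1 / p)) powr p / p + (q powr (1 / p)) powr r / r"
    using assms r by (intro Youngs_inequality) auto
  moreover have "t\<^sup>2 / q powr (1 / p) * q powr (1 / p) = t\<^sup>2"
    using assms by simp
  moreover have "(t\<^sup>2 / q powr (1 / p)) powr p = t powr (2 * p) / q"
  proof -
    have "t\<^sup>2 = t powr 2" using \<open>t \<ge> 0\<close> by (simp add: powr_numeral)
    then have "t\<^sup>2 powr p = t powr (2 * p)" by (simp only: powr_powr)
    then show ?thesis using assms by (simp add: powr_divide powr_powr)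
  qed
  moreover have "(q powr (1 / p)) powr r = q powr (1 / (p - 1))"
    using \<open>p > 1\<close> by (simp add: powr_powr r_def)
  ultimately have "t\<^sup>2 \<le> t powr (2 * p) / q / p + q powr (1 / (p - 1)) / r"
    by (simp only:)
  also have "q powr (1 / (p - 1)) / r = q powr (1 / (p - 1)) * (1 / r)"
    by simp
  also have "1 / r = 1 - 1 / p" using r(2) by linarith
  finally show ?thesis
    by (simp add: algebra_simps)
qed

lemma dilation_profile_nonpos:
  fixes p q t :: real
  assumes "p > 1" and "q > 0" and "t \<ge> (p * q) powr (1 / (2 * p - 2))"
  shows "t\<^sup>2 / 2 - t powr (2 * p) / (2 * p * q) \<le> 0"
proof -
  have "t > 0"
    using assms by (intro less_le_trans[OF _ assms(3)]) auto
  have "p * q = ((p * q) powr (1 / (2 * p - 2))) powr (2 * p - 2)"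
    using assms by (simp add: powr_powr)
  also have "\<dots> \<le> t powr (2 * p - 2)"
    using assms by (intro powr_mono2) auto
  finally have "t\<^sup>2 * (p * q) \<le> t\<^sup>2 * t powr (2 * p - 2)"
    by (intro mult_left_mono) auto
  also have "\<dots> = t powr (2 * p)"
  proof -
    have "t\<^sup>2 = t powr 2" using \<open>t > 0\<close> by (simp add: powr_numeral)
    then show ?thesis by (simp flip: powr_add)
  qed
  finally show ?thesis
    using assms by (simp add: field_simps)
qed

text \<open>
  The energy of $(tU_1, sU_2)$ as a function of $t$ and $s$, with $A_i$ for the squared norm of $U_i$ and $D$
  for the integral of $|U_1 U_2|^p$. On the axes, and where $t$ or $s$ is large, one of the two profiles
  is at most $0$ and $F$ is at most $\mu A_1$ or $\mu A_2$. The bound on $D$ gives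
  $F(1, 1) \ge \kappa(A_1 + A_2)$, which by assumption is larger. So $F$ attains its maximum over the
  open quadrant, inside a compact square. At the maximum point the coupling term is
  strictly positive, which makes the bound strict.
\<close>

lemma coupled_profile_max:
  fixes A\<^sub>1 A\<^sub>2 D \<beta> p :: real
  defines "q \<equiv> 1 + \<beta>"
  defines "h \<equiv> \<lambda>t. t\<^sup>2 / 2 - t powr (2 * p) / (2 * p * q)"
  defines "F \<equiv> \<lambda>t s. A\<^sub>1 * h t + A\<^sub>2 * h s - \<beta> / p * (t powr p * s powr p * D)"
  defines "\<kappa> \<equiv> 1 / 2 - 1 / (2 * p)"
  defines "\<mu> \<equiv> \<kappa> * q powr (1 / (p - 1))"
  assumes p: "p > 1" and "\<beta> > 0" and A: "A\<^sub>1 > 0" "A\<^sub>2 > 0"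
    and D: "D > 0" "D \<le> (A\<^sub>1 / q + A\<^sub>2 / q) / 2"
    and small: "\<mu> * A\<^sub>1 < \<kappa> * (A\<^sub>1 + A\<^sub>2)" "\<mu> * A\<^sub>2 < \<kappa> * (A\<^sub>1 + A\<^sub>2)"
  shows "(GREATEST c. \<exists>t>0. \<exists>s>0. c = F t s) < \<mu> * (A\<^sub>1 + A\<^sub>2)"
proof -
  have q: "q > 1" using \<open>\<beta> > 0\<close> by (simp add: q_def)
  define R where "R = (p * q) powr (1 / (2 * p - 2))"
  have "1 * 1 \<le> p * q"
    using p q by (intro mult_mono) auto
  then have R: "R \<ge> 1"
    using p unfolding R_def by (intro ge_one_powr_ge_zero) auto
  have h_le: "h t \<le> \<mu>" if "t \<ge> 0" for t
    unfolding h_def \<mu>_def \<kappa>_def using that p q by (intro dilation_profile_le) auto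
  have h_nonpos: "h t \<le> 0" if "t = 0 \<or> t \<ge> R" for t
    using that p q dilation_profile_nonpos[of p q t] by (auto simp: h_def R_def)
  have coupling: "\<beta> / p * (t powr p * s powr p * D) \<ge> 0" for t s
    using \<open>\<beta> > 0\<close> p D by simp
  \<comment> \<open>with $D$ at its largest, the coupling turns the factor $1/q$ of both nonlinear terms into $(1 + \beta)/q = 1$\<close>
  have F11: "\<kappa> * (A\<^sub>1 + A\<^sub>2) \<le> F 1 1"
  proof -
    have "\<beta> / p * D \<le> \<beta> / p * ((A\<^sub>1 / q + A\<^sub>2 / q) / 2)"
      using D \<open>\<beta> > 0\<close> p by (intro mult_left_mono) auto
    moreover have "F 1 1 = (A\<^sub>1 + A\<^sub>2) * (1 / 2 - 1 / (2 * p * q)) - \<beta> / p * D"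
      by (simp add: F_def h_def distrib_right)
    ultimately have "F 1 1 \<ge> (A\<^sub>1 + A\<^sub>2) * (1 / 2 - 1 / (2 * p * q)) - \<beta> / p * ((A\<^sub>1 / q + A\<^sub>2 / q) / 2)"
      by linarith
    also have "(A\<^sub>1 + A\<^sub>2) * (1 / 2 - 1 / (2 * p * q)) - \<beta> / p * ((A\<^sub>1 / q + A\<^sub>2 / q) / 2)
        = (A\<^sub>1 + A\<^sub>2) * (1 / 2 - (1 + \<beta>) / (2 * p * q))"
      using p q by (simp add: field_simps)
    also have "\<dots> = \<kappa> * (A\<^sub>1 + A\<^sub>2)"
      using p q unfolding q_def[symmetric] by (simp add: \<kappa>_def)
    finally show ?thesis .
  qed
  have outside: "F t s < F 1 1" if ts: "t \<ge> 0" "s \<ge> 0" and "t = 0 \<or> t \<ge> R \<or> s = 0 \<or> s \<ge> R" for t s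
  proof -
    have "h t \<le> 0 \<or> h s \<le> 0" using that h_nonpos by blast
    then have "A\<^sub>1 * h t + A\<^sub>2 * h s \<le> \<mu> * A\<^sub>1 \<or> A\<^sub>1 * h t + A\<^sub>2 * h s \<le> \<mu> * A\<^sub>2"
    proof
      assume "h t \<le> 0"
      then have "A\<^sub>1 * h t \<le> 0" using A by (simp add: mult_le_0_iff)
      moreover have "A\<^sub>2 * h s \<le> A\<^sub>2 * \<mu>" using A h_le[OF ts(2)] by (intro mult_left_mono) auto
      ultimately show ?thesis by (simp add: mult.commute)
    next
      assume "h s \<le> 0"
      then have "A\<^sub>2 * h s \<le> 0" using A by (simp add: mult_le_0_iff)
      moreover have "A\<^sub>1 * h t \<le> A\<^sub>1 * \<mu>" using A h_le[OF ts(1)] by (intro mult_left_mono) auto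
      ultimately show ?thesis by (simp add: mult.commute)
    qed
    then have "F t s \<le> \<mu> * A\<^sub>1 \<or> F t s \<le> \<mu> * A\<^sub>2"
      using coupling[of t s] unfolding F_def by linarith
    with small F11 show ?thesis by linarith
  qed
  have "continuous_on ({0..R} \<times> {0..R}) (\<lambda>z. F (fst z) (snd z))"
  proof -
    let ?S = "{0..R} \<times> {0..R}"
    have proj: "continuous_on ?S fst" "continuous_on ?S snd"
      by (intro continuous_on_fst continuous_on_snd continuous_on_id)+
    have pw: "continuous_on ?S (\<lambda>z. fst z powr e)" "continuous_on ?S (\<lambda>z. snd z powr e)"
      if "e > 0" for e
      by (rule continuous_on_powr'; use proj that in \<open>auto\<close>)+
    have "p > 0" "2 * p > 0" "2 * p * q \<noteq> 0" using p q by auto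
    then show ?thesis
      unfolding F_def h_def
      by (intro continuous_on_add continuous_on_diff continuous_on_mult continuous_on_divide
          continuous_on_power continuous_on_const proj pw ballI) simp_all
  qed
  moreover have "compact ({0..R} \<times> {0..R})" by (intro compact_Times compact_Icc)
  moreover have "({0..R} \<times> {0..R}) \<noteq> {}" using R by auto
  ultimately have "\<exists>z\<in>{0..R} \<times> {0..R}. \<forall>y\<in>{0..R} \<times> {0..R}. F (fst y) (snd y) \<le> F (fst z) (snd z)"
    by (intro continuous_attains_sup)
  then obtain t s where ts: "t \<in> {0..R}" "s \<in> {0..R}"
    and max: "\<And>t' s'. t' \<in> {0..R} \<Longrightarrow> s' \<in> {0..R} \<Longrightarrow> F t' s' \<le> F t s"
    by auto
  have ge: "F 1 1 \<le> F t s" using R by (intro max) auto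
  then have pos: "t > 0" "s > 0"
    using outside[of t s] ts by (auto simp: not_less less_le)
  have "(GREATEST c. \<exists>t>0. \<exists>s>0. c = F t s) = F t s"
  proof (rule Greatest_equality)
    show "\<exists>t'>0. \<exists>s'>0. F t s = F t' s'" using pos by blast
    fix c assume "\<exists>t>0. \<exists>s>0. c = F t s"
    then obtain t' s' where c: "t' > 0" "s' > 0" "c = F t' s'" by blast
    show "c \<le> F t s"
    proof (cases "t' \<le> R \<and> s' \<le> R")
      case True
      then show ?thesis using c max[of t' s'] by simp
    next
      case False
      then have "F t' s' < F 1 1" using c by (intro outside) auto
      then show ?thesis using ge c by linarith
    qed
  qed
  also have "F t s < A\<^sub>1 * h t + A\<^sub>2 * h s"
    using pos D \<open>\<beta> > 0\<close> p by (simp add: F_def)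
  also have "\<dots> \<le> A\<^sub>1 * \<mu> + A\<^sub>2 * \<mu>"
    using A pos h_le by (intro add_mono mult_left_mono) auto
  finally show ?thesis by (simp add: algebra_simps)
qed

text \<open>
  The product is integrable and its integral is bounded by the inequality between arithmetic and
  geometric mean, applied to $|u|^{2p}$ and $|v|^{2p}$ at every point.
\<close>

lemma
  fixes u v :: "real ^ 'n \<Rightarrow> real"
  assumes u: "u \<in> borel_measurable borel" "\<And>x. u x > 0" "integrable lborel (\<lambda>x. \<bar>u x\<bar> powr (2 * p))"
    and v: "v \<in> borel_measurable borel" "\<And>x. v x > 0" "integrable lborel (\<lambda>x. \<bar>v x\<bar> powr (2 * p))"
  shows product_integral_le: "(\<integral>x. \<bar>u x * v x\<bar> powr p \<partial>lborel)
      \<le> ((\<integral>x. \<bar>u x\<bar> powr (2 * p) \<partial>lborel) + (\<integral>x. \<bar>v x\<bar> powr (2 * p) \<partial>lborel)) / 2"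
    and product_integral_pos: "(\<integral>x. \<bar>u x * v x\<bar> powr p \<partial>lborel) > 0"
proof -
  have le: "\<bar>a * b\<bar> powr p \<le> (\<bar>a\<bar> powr (2 * p) + \<bar>b\<bar> powr (2 * p)) / 2" for a b :: real
  proof -
    have sq: "\<bar>a\<bar> powr (2 * p) = (\<bar>a\<bar> powr p)\<^sup>2" for a :: real
      by (simp add: power2_eq_square flip: powr_add)
    show ?thesis
      using sum_squares_bound[of "\<bar>a\<bar> powr p" "\<bar>b\<bar> powr p"]
      by (simp add: sq abs_mult powr_mult)
  qed
  have "integrable lborel (\<lambda>x. (\<bar>u x\<bar> powr (2 * p) + \<bar>v x\<bar> powr (2 * p)) / 2)"
    using u(3) v(3) by simp
  moreover have "(\<lambda>x. \<bar>u x * v x\<bar> powr p) \<in> borel_measurable lborel"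
    using u(1) v(1) by simp
  ultimately have int: "integrable lborel (\<lambda>x. \<bar>u x * v x\<bar> powr p)"
    by (rule Bochner_Integration.integrable_bound) (use le in auto)
  have "(\<integral>x. \<bar>u x * v x\<bar> powr p \<partial>lborel)
      \<le> (\<integral>x. (\<bar>u x\<bar> powr (2 * p) + \<bar>v x\<bar> powr (2 * p)) / 2 \<partial>lborel)"
    using u(3) v(3) by (intro integral_mono int le) simp
  also have "\<dots> = ((\<integral>x. \<bar>u x\<bar> powr (2 * p) \<partial>lborel) + (\<integral>x. \<bar>v x\<bar> powr (2 * p) \<partial>lborel)) / 2"
    using u(3) v(3) by simp
  finally show "(\<integral>x. \<bar>u x * v x\<bar> powr p \<partial>lborel)
      \<le> ((\<integral>x. \<bar>u x\<bar> powr (2 * p) \<partial>lborel) + (\<integral>x. \<bar>v x\<bar> powr (2 * p) \<partial>lborel)) / 2" .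
  have "\<bar>u x * v x\<bar> powr p > 0" for x
    using u(2)[of x] v(2)[of x] by simp
  then have "\<not> (AE x in lborel. \<bar>u x * v x\<bar> powr p = 0)"
    by (rule positive_not_AE_zero)
  then have "(\<integral>x. \<bar>u x * v x\<bar> powr p \<partial>lborel) \<noteq> 0"
    using int by (subst integral_nonneg_eq_0_iff_AE) auto
  then show "(\<integral>x. \<bar>u x * v x\<bar> powr p \<partial>lborel) > 0"
    by (simp add: less_le)
qed

text \<open>
  The factor $(1 + \beta)^{1/(p-1)}$ by which the profile maxima exceed the levels at $\beta$ is the one that
  leads back to the levels at $0$. The smallness assumptions say that each single level at $0$, which
  is the maximum on one axis, is below the sum of the levels at $\beta$; they hold for small $\beta$.
\<close>

lemma C_star_less:
  fixes U :: "real \<Rightarrow> real \<Rightarrow> real ^ 'n \<Rightarrow> real"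
  assumes ground: "\<And>\<alpha> b. \<alpha> > 0 \<Longrightarrow> b \<ge> 0 \<Longrightarrow> ground_state p \<alpha> b (U \<alpha> b)"
    and p: "p > 1" and m: "m\<^sub>1 > 0" "m\<^sub>2 > 0" and "\<beta> > 0"
    and small: "C_level p U m\<^sub>1 0 < C_level p U m\<^sub>1 \<beta> + C_level p U m\<^sub>2 \<beta>"
      "C_level p U m\<^sub>2 0 < C_level p U m\<^sub>1 \<beta> + C_level p U m\<^sub>2 \<beta>"
  shows "C_star p U m\<^sub>1 m\<^sub>2 \<beta> < C_level p U m\<^sub>1 0 + C_level p U m\<^sub>2 0"
proof -
  define q where "q = 1 + \<beta>"
  define \<kappa> where "\<kappa> = 1 / 2 - 1 / (2 * p)"
  define u where "u = U m\<^sub>1 \<beta>"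
  define v where "v = U m\<^sub>2 \<beta>"
  define A\<^sub>1 where "A\<^sub>1 = H1_norm_sq m\<^sub>1 u"
  define A\<^sub>2 where "A\<^sub>2 = H1_norm_sq m\<^sub>2 v"
  define D where "D = (\<integral>x. \<bar>u x * v x\<bar> powr p \<partial>lborel)"
  have gs: "ground_state p m\<^sub>1 \<beta> u" "ground_state p m\<^sub>2 \<beta> v"
    using ground m \<open>\<beta> > 0\<close> by (simp_all add: u_def v_def)
  then have sol: "weak_solution p m\<^sub>1 \<beta> u" "weak_solution p m\<^sub>2 \<beta> v"
    and pos: "\<And>x. u x > 0" "\<And>x. v x > 0"
    unfolding ground_state_def by blast+
  have H: "u \<in> H1" "v \<in> H1" using sol unfolding weak_solution_def by blast+
  have nz: "\<not> (AE x in lborel. u x = 0)" "\<not> (AE x in lborel. v x = 0)"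
    by (intro positive_not_AE_zero pos)+
  have q: "q > 1" using \<open>\<beta> > 0\<close> by (simp add: q_def)
  have A: "A\<^sub>1 > 0" "A\<^sub>2 > 0"
    unfolding A\<^sub>1_def A\<^sub>2_def
    by (rule weak_solution_norm_pos[OF sol(1) nz(1) m(1)], rule weak_solution_norm_pos[OF sol(2) nz(2) m(2)])
  have B: "(\<integral>x. \<bar>u x\<bar> powr (2 * p) \<partial>lborel) = A\<^sub>1 / q" "(\<integral>x. \<bar>v x\<bar> powr (2 * p) \<partial>lborel) = A\<^sub>2 / q"
    using weak_solution_energy[OF sol(1) nz(1) m(1)] weak_solution_energy[OF sol(2) nz(2) m(2)] q
    by (simp_all add: A\<^sub>1_def A\<^sub>2_def q_def)
  note int = weak_solution_integrable[OF sol(1) nz(1) m(1)] weak_solution_integrable[OF sol(2) nz(2) m(2)]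
  have D: "D > 0" "D \<le> (A\<^sub>1 / q + A\<^sub>2 / q) / 2"
    using product_integral_pos[OF H1_measurable(1)[OF H(1)] pos(1) int(1) H1_measurable(1)[OF H(2)] pos(2) int(2)]
      product_integral_le[OF H1_measurable(1)[OF H(1)] pos(1) int(1) H1_measurable(1)[OF H(2)] pos(2) int(2)]
    unfolding D_def B by blast+
  have \<beta>_max: "max \<beta> 0 = \<beta>" "max 0 0 = (0 :: real)" using \<open>\<beta> > 0\<close> by auto
  have "p > 0" using p by simp
  then have level: "C_level p U m\<^sub>1 \<beta> = \<kappa> * A\<^sub>1" "C_level p U m\<^sub>2 \<beta> = \<kappa> * A\<^sub>2"
    unfolding C_level_def \<beta>_max \<kappa>_def A\<^sub>1_def A\<^sub>2_def u_def[symmetric] v_def[symmetric]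
    using J_scalar_weak_solution[OF sol(1) nz(1) m(1)] J_scalar_weak_solution[OF sol(2) nz(2) m(2)]
    by blast+
  have level0: "C_level p U m 0 = q powr (1 / (p - 1)) * C_level p U m \<beta>" if "m > 0" for m
  proof -
    have gm: "ground_state p m \<beta> (U m \<beta>)" "ground_state p m 0 (U m 0)"
      using that \<open>\<beta> > 0\<close> by (intro ground; simp)+
    have "C_level p U m 0 = ((1 + 0) / (1 + \<beta>)) powr (- (1 / (p - 1)))
           * (m / m) powr (p / (p - 1) - real CARD('n) / 2) * C_level p U m \<beta>"
      unfolding C_level_def \<beta>_max
      using that \<open>\<beta> > 0\<close> by (intro ground_state_level gm p) simp_all
    also have "((1 + 0) / (1 + \<beta>)) powr (- (1 / (p - 1))) = q powr (1 / (p - 1))"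
      using q unfolding q_def[symmetric] by (simp add: powr_divide powr_minus_divide)
    finally show ?thesis
      using that by simp
  qed
  have small': "\<kappa> * q powr (1 / (p - 1)) * A\<^sub>1 < \<kappa> * (A\<^sub>1 + A\<^sub>2)"
    "\<kappa> * q powr (1 / (p - 1)) * A\<^sub>2 < \<kappa> * (A\<^sub>1 + A\<^sub>2)"
    using small unfolding level0[OF m(1)] level0[OF m(2)] level by (simp_all add: algebra_simps)
  let ?h = "\<lambda>t. t\<^sup>2 / 2 - t powr (2 * p) / (2 * p * q)"
  let ?F = "\<lambda>t s. A\<^sub>1 * ?h t + A\<^sub>2 * ?h s - \<beta> / p * (t powr p * s powr p * D)"
  have J: "J_system p m\<^sub>1 m\<^sub>2 \<beta> (\<lambda>x. t * u x, \<lambda>x. s * v x) = ?F t s" if "t > 0" "s > 0" for t s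
  proof -
    have "Lq_norm (2 * p) (\<lambda>x. t * u x) powr (2 * p) = t powr (2 * p) * (A\<^sub>1 / q)"
      using p that by (simp add: Lq_norm_powr abs_mult powr_mult B)
    moreover have "Lq_norm (2 * p) (\<lambda>x. s * v x) powr (2 * p) = s powr (2 * p) * (A\<^sub>2 / q)"
      using p that by (simp add: Lq_norm_powr abs_mult powr_mult B)
    moreover have "Lq_norm p (\<lambda>x. t * u x * (s * v x)) powr p = t powr p * s powr p * D"
    proof -
      have "\<bar>t * u x * (s * v x)\<bar> powr p = t powr p * s powr p * \<bar>u x * v x\<bar> powr p" for x
        using that by (simp add: abs_mult powr_mult)
      then show ?thesis using p by (simp add: Lq_norm_powr D_def)
    qed
    ultimately show ?thesis
      unfolding J_system_def by (simp add: H1_norm_sq_mult[OF H(1)] H1_norm_sq_mult[OF H(2)]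
          A\<^sub>1_def[symmetric] A\<^sub>2_def[symmetric] algebra_simps)
  qed
  have "C_star p U m\<^sub>1 m\<^sub>2 \<beta> = (GREATEST c. \<exists>t>0. \<exists>s>0. c = ?F t s)"
  proof -
    have "(\<exists>t>0. \<exists>s>0. c = J_system p m\<^sub>1 m\<^sub>2 \<beta> (\<lambda>x. t * u x, \<lambda>x. s * v x))
        \<longleftrightarrow> (\<exists>t>0. \<exists>s>0. c = ?F t s)" for c
      using J by metis
    then show ?thesis
      using \<open>\<beta> > 0\<close> by (simp add: C_star_def u_def v_def)
  qed
  also have "\<dots> < \<kappa> * q powr (1 / (p - 1)) * (A\<^sub>1 + A\<^sub>2)"
    unfolding q_def \<kappa>_def
    by (rule coupled_profile_max[OF p \<open>\<beta> > 0\<close> A D[unfolded q_def] small'[unfolded \<kappa>_def q_def]])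
  also have "\<dots> = C_level p U m\<^sub>1 0 + C_level p U m\<^sub>2 0"
    using level0[OF m(1)] level0[OF m(2)] level by (simp add: algebra_simps)
  finally show ?thesis .
qed

section \<open>Separation of the levels\<close>

lemma subcritical_exponent_pos:
  fixes p :: real
  assumes "ereal (2 * p) \<in> {2<..<crit_exponent N}"
  shows "p > 1" and "p / (p - 1) - real N / 2 > 0"
proof -
  have "ereal 2 < ereal (2 * p)" using assms by simp
  then show p: "p > 1" by simp
  show "p / (p - 1) - real N / 2 > 0"
  proof (cases "N \<ge> 3")
    case True
    then have "2 * p < 2 * real N / (real N - 2)"
      using assms by (simp add: crit_exponent_def)
    then have "p * (real N - 2) < real N"
      using True by (simp add: field_simps)
    then show ?thesis
      using p by (simp add: field_simps)
  next
    case False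
    then have "real N / 2 \<le> 1" by simp
    also have "1 < p / (p - 1)" using p by simp
    finally show ?thesis by simp
  qed
qed

theorem theorem1p1:
  fixes p m\<^sub>1 m\<^sub>2 :: real
    and U :: "real \<Rightarrow> real \<Rightarrow> real ^ 'n \<Rightarrow> real"
  assumes "ereal (2 * p) \<in> {2<..<crit_exponent CARD('n)}"
    and "0 < m\<^sub>1" and "m\<^sub>1 \<le> m\<^sub>2"
    and "\<And>\<alpha> b. \<alpha> > 0 \<Longrightarrow> b \<ge> 0 \<Longrightarrow> ground_state p \<alpha> b (U \<alpha> b)"
  shows "\<exists>\<beta>' > 0. \<exists>\<theta> :: real \<Rightarrow> real.
           \<theta> \<in> {0<..<\<beta>'} \<rightarrow> {0<..} \<and> strict_antimono_on {0<..<\<beta>'} \<theta> \<and>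
           (\<forall>\<beta>\<in>{0<..<\<beta>'}. \<forall>k :: nat.
              \<not> (\<exists>\<delta> :: nat \<Rightarrow> real. (\<forall>i\<in>{1..k}. \<delta> i \<in> {0..<\<theta> \<beta>}) \<and>
                   (\<Sum>i=1..k. C_level p U (m\<^sub>1 + \<delta> i) 0)
                     \<in> {C_level p U m\<^sub>1 \<beta> + C_level p U m\<^sub>2 \<beta> .. C_star p U m\<^sub>1 m\<^sub>2 \<beta>}))"
proof -
  define \<gamma> where "\<gamma> = p / (p - 1) - real CARD('n) / 2"
  have p: "p > 1" and \<gamma>: "\<gamma> > 0"
    using subcritical_exponent_pos[OF assms(1)] by (simp_all add: \<gamma>_def)
  note m1 = assms(2)
  have m2: "m\<^sub>2 > 0" using assms(2,3) by simp
  note ground = assms(4)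
  define c\<^sub>1 where "c\<^sub>1 = C_level p U m\<^sub>1 0"
  define c\<^sub>2 where "c\<^sub>2 = C_level p U m\<^sub>2 0"
  define L where "L = c\<^sub>1 + c\<^sub>2"
  have level: "C_level p U m b = (1 + b) powr (- (1 / (p - 1))) * (m / m') powr \<gamma> * C_level p U m' 0"
    if "m > 0" "m' > 0" "b \<ge> 0" for m m' b
  proof -
    have "max b 0 = b" "max 0 0 = (0 :: real)" using that by auto
    then show ?thesis
      using ground_state_level[OF ground[OF that(2) order.refl] ground[OF that(1,3)] p that(2,1) order.refl that(3)]
      by (simp only: C_level_def \<gamma>_def add_0_right div_by_1)
  qed
  have c_pos: "C_level p U m 0 > 0" if "m > 0" for m
  proof -
    have gs: "ground_state p m 0 (U m 0)" using that by (intro ground) auto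
    then have sol: "weak_solution p m 0 (U m 0)" and pos: "\<And>x. U m 0 x > 0"
      unfolding ground_state_def by blast+
    have nz: "\<not> (AE x in lborel. U m 0 x = 0)" by (intro positive_not_AE_zero pos)
    have "J_scalar p m 0 (U m 0) = (1 / 2 - 1 / (2 * p)) * H1_norm_sq m (U m 0)"
      using p by (intro J_scalar_weak_solution sol nz that) auto
    moreover have "1 / 2 - 1 / (2 * p) > 0" using p by (simp add: field_simps)
    ultimately show ?thesis
      using weak_solution_norm_pos[OF sol nz that] by (simp add: C_level_def)
  qed
  have c: "c\<^sub>1 > 0" "c\<^sub>2 > 0" using c_pos m1 m2 by (simp_all add: c\<^sub>1_def c\<^sub>2_def)
  \<comment> \<open>the least number of summands that reach $L$ when all $\delta_i = 0$\<close>
  define K where "K = nat \<lceil>L / c\<^sub>1\<rceil>"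
  have "L / c\<^sub>1 > 0" using c by (simp add: L_def)
  then have "real K - 1 < L / c\<^sub>1" "L / c\<^sub>1 \<le> real K"
    unfolding K_def by linarith+
  then have K: "(real K - 1) * c\<^sub>1 < L" "L \<le> real K * c\<^sub>1"
    using c by (simp_all add: field_simps)
  \<comment> \<open>everything that has to stay below the lower end of the interval: each single level,
    for the attainment of the maximum, and the largest sum that does not reach $L$\<close>
  define X where "X = max (max c\<^sub>1 c\<^sub>2) ((real K - 1) * c\<^sub>1)"
  have X: "c\<^sub>1 \<le> X" "c\<^sub>2 \<le> X" "(real K - 1) * c\<^sub>1 \<le> X" "0 < X" "X < L"
    using c K by (auto simp: X_def L_def)
  define Y where "Y = (X + L) / 2"
  have Y: "X < Y" "Y < L" "0 < Y" using X by (simp_all add: Y_def)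
  \<comment> \<open>chosen such that $(1 + \beta)^{-1/(p-1)} L > Y$ for $\beta < \beta'$, and
    $(1 + \delta/\mathsf m_1)^\gamma < Y / X$ for $\delta < d$\<close>
  define \<beta>' where "\<beta>' = (L / Y) powr (p - 1) - 1"
  define d where "d = m\<^sub>1 * ((Y / X) powr (1 / \<gamma>) - 1)"
  have \<beta>': "\<beta>' > 0"
    using Y p powr_less_mono2[of "p - 1" 1 "L / Y"] by (simp add: \<beta>'_def)
  have d: "d > 0"
    using X Y \<gamma> m1 powr_less_mono2[of "1 / \<gamma>" 1 "Y / X"] by (simp add: d_def)
  \<comment> \<open>dividing by $1 + \beta$ keeps $\theta \le d$ and makes $\theta$ strictly decreasing\<close>
  define \<theta> where "\<theta> = (\<lambda>\<beta> :: real. d / (1 + \<beta>))"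
  show ?thesis
  proof (intro exI conjI ballI allI)
    show "\<beta>' > 0" by fact
    show "\<theta> \<in> {0<..<\<beta>'} \<rightarrow> {0<..}"
      using d by (auto simp: \<theta>_def)
    show "strict_antimono_on {0<..<\<beta>'} \<theta>"
      using d by (auto simp: \<theta>_def monotone_on_def intro!: divide_strict_left_mono)
    fix \<beta> k assume \<beta>: "\<beta> \<in> {0<..<\<beta>'}"
    define lo where "lo = C_level p U m\<^sub>1 \<beta> + C_level p U m\<^sub>2 \<beta>"
    have "(1 + \<beta>) powr (1 / (p - 1)) < ((L / Y) powr (p - 1)) powr (1 / (p - 1))"
      using \<beta> p by (intro powr_less_mono2) (auto simp: \<beta>'_def)
    also have "\<dots> = L / Y" using p X Y by (simp add: powr_powr)
    finally have "(1 + \<beta>) powr (1 / (p - 1)) * Y < L"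
      using Y by (simp add: field_simps)
    moreover have "(1 + \<beta>) powr (1 / (p - 1)) > 0" using \<beta> by simp
    ultimately have "Y < L / (1 + \<beta>) powr (1 / (p - 1))"
      by (simp add: pos_less_divide_eq mult.commute)
    also have "L / (1 + \<beta>) powr (1 / (p - 1)) = lo"
      using level[of m\<^sub>1 m\<^sub>1 \<beta>] level[of m\<^sub>2 m\<^sub>2 \<beta>] m1 m2 \<beta>
      by (simp add: lo_def L_def c\<^sub>1_def c\<^sub>2_def powr_minus_divide add_divide_distrib)
    finally have lo: "Y < lo" .
    have star: "C_star p U m\<^sub>1 m\<^sub>2 \<beta> < L"
      unfolding L_def c\<^sub>1_def c\<^sub>2_def
      using \<beta> lo X Y
      by (intro C_star_less ground p m1 m2) (auto simp: lo_def c\<^sub>1_def c\<^sub>2_def)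
    show "\<not> (\<exists>\<delta> :: nat \<Rightarrow> real. (\<forall>i\<in>{1..k}. \<delta> i \<in> {0..<\<theta> \<beta>}) \<and>
           (\<Sum>i=1..k. C_level p U (m\<^sub>1 + \<delta> i) 0)
             \<in> {C_level p U m\<^sub>1 \<beta> + C_level p U m\<^sub>2 \<beta> .. C_star p U m\<^sub>1 m\<^sub>2 \<beta>})"
    proof
      assume "\<exists>\<delta> :: nat \<Rightarrow> real. (\<forall>i\<in>{1..k}. \<delta> i \<in> {0..<\<theta> \<beta>}) \<and>
           (\<Sum>i=1..k. C_level p U (m\<^sub>1 + \<delta> i) 0)
             \<in> {C_level p U m\<^sub>1 \<beta> + C_level p U m\<^sub>2 \<beta> .. C_star p U m\<^sub>1 m\<^sub>2 \<beta>}"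
      then obtain \<delta> :: "nat \<Rightarrow> real" where \<delta>: "\<forall>i\<in>{1..k}. \<delta> i \<in> {0..<\<theta> \<beta>}"
        and mem: "(\<Sum>i=1..k. C_level p U (m\<^sub>1 + \<delta> i) 0) \<in> {lo .. C_star p U m\<^sub>1 m\<^sub>2 \<beta>}"
        unfolding lo_def by blast
      have sum: "lo \<le> (\<Sum>i=1..k. C_level p U (m\<^sub>1 + \<delta> i) 0)"
          "(\<Sum>i=1..k. C_level p U (m\<^sub>1 + \<delta> i) 0) \<le> C_star p U m\<^sub>1 m\<^sub>2 \<beta>"
        using mem unfolding atLeastAtMost_iff by blast+
      have bounds: "c\<^sub>1 \<le> C_level p U (m\<^sub>1 + \<delta> i) 0 \<and> C_level p U (m\<^sub>1 + \<delta> i) 0 \<le> Y / X * c\<^sub>1"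
        if "i \<in> {1..k}" for i
      proof -
        define r where "r = (m\<^sub>1 + \<delta> i) / m\<^sub>1"
        have \<delta>_i: "0 \<le> \<delta> i" "\<delta> i < d"
        proof -
          have "\<theta> \<beta> \<le> d" using d \<beta> by (simp add: \<theta>_def field_simps)
          then show "0 \<le> \<delta> i" "\<delta> i < d" using bspec[OF \<delta> that] by auto
        qed
        have eq: "C_level p U (m\<^sub>1 + \<delta> i) 0 = r powr \<gamma> * c\<^sub>1"
          using level[of "m\<^sub>1 + \<delta> i" m\<^sub>1 0] m1 \<delta>_i by (simp add: r_def c\<^sub>1_def)
        have r: "1 \<le> r" "r \<le> (Y / X) powr (1 / \<gamma>)"
          using m1 \<delta>_i by (simp_all add: r_def d_def field_simps)
        have "1 \<le> r powr \<gamma>" using r \<gamma> by (intro ge_one_powr_ge_zero) auto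
        moreover have "r powr \<gamma> \<le> ((Y / X) powr (1 / \<gamma>)) powr \<gamma>"
          using r \<gamma> by (intro powr_mono2) auto
        moreover have "((Y / X) powr (1 / \<gamma>)) powr \<gamma> = Y / X"
          using X Y \<gamma> by (simp add: powr_powr)
        ultimately have "1 * c\<^sub>1 \<le> r powr \<gamma> * c\<^sub>1" "r powr \<gamma> * c\<^sub>1 \<le> Y / X * c\<^sub>1"
          using c by (simp_all only: mult_right_mono less_imp_le)
        then show ?thesis unfolding eq by simp
      qed
      show False
      proof (cases "k \<ge> K")
        case True
        have "L \<le> real K * c\<^sub>1" by (rule K)
        also have "\<dots> \<le> real k * c\<^sub>1" using True c by (intro mult_right_mono) auto
        also have "\<dots> = (\<Sum>i=1..k. c\<^sub>1)" by simp
        also have "\<dots> \<le> (\<Sum>i=1..k. C_level p U (m\<^sub>1 + \<delta> i) 0)"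
          using bounds by (intro sum_mono) blast
        finally show False using sum star by linarith
      next
        case False
        have "(\<Sum>i=1..k. C_level p U (m\<^sub>1 + \<delta> i) 0) \<le> (\<Sum>i=1..k. Y / X * c\<^sub>1)"
          using bounds by (intro sum_mono) blast
        also have "\<dots> = Y / X * (real k * c\<^sub>1)" by simp
        also have "\<dots> \<le> Y / X * X"
        proof (rule mult_left_mono)
          have "real k * c\<^sub>1 \<le> (real K - 1) * c\<^sub>1"
            using False c by (intro mult_right_mono) auto
          then show "real k * c\<^sub>1 \<le> X" using X by linarith
          show "0 \<le> Y / X" using X Y by simp
        qed
        also have "\<dots> = Y" using X by simp
        finally show False using sum lo by linarith
      qed
    qed
  qed
qed

end
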